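(* There is a countable collection $\mathcal G_D$ of nonempty finite words over the alphabet $\{+,-\}$ which uniquely represents $X_{\mathrm{con}}(\mathcal G_D)$, whose coded shift is the full shift $X:=X(\mathcal G_D)=\{+,-\}^{\mathbb Z}$, and such that \[ P_{\rm res}(\varphi,\mathcal G_D)=P_X(\varphi)\qquad\text{for every }\varphi\in C(X), \] whereas \[ P_{\rm seq}(0,\mathcal G_D)=h_{\mathrm{top}}(X)=\log 2 . \] Consequently, \[ \operatorname{SSP}(X,\mathcal G_D)=\operatorname{FSSP}(X,\mathcal G_D)=\varnothing,\qquad 0\in\operatorname{FSP}(X,\mathcal G_D), \] and hence $\operatorname{FSP}(X,\mathcal G_D)\neq\operatorname{FSSP}(X,\mathcal G_D)$.
   Context: For a finite alphabet $\mathcal A$, $\mathcal A^{\mathbb Z}$ carries the product topology and the left shift $\sigma$. For a nonempty countable collection $\mathcal G$ of nonempty finite words over $\mathcal A$, the concatenation set $X_{\mathrm{con}}(\mathcal G)\subset\mathcal A^{\mathbb Z}$ is the set of all points obtained by bi-infinite concatenation of words in $\mathcal G$ (with any position of the origin); the coded shift is $X(\mathcal G)=\overline{X_{\mathrm{con}}(\mathcal G)}$; the residual set is $X_{\mathrm{res}}(\mathcal G)=X(\mathcal G)\setminus X_{\mathrm{con}}(\mathcal G)$. A pointed $\mathcal G$-representation of $x\in X_{\mathrm{con}}(\mathcal G)$ is a pair $((g_j)_{j\in\mathbb Z},k)$ with $g_j\in\mathcal G$, $0\le k<|g_0|$, and $x=\sigma^k(\cdots g_{-1}.g_0g_1\cdots)$,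 where the dot marks coordinate zero. $\mathcal G$ uniquely represents $X_{\mathrm{con}}(\mathcal G)$ if every point of $X_{\mathrm{con}}(\mathcal G)$ has exactly one pointed $\mathcal G$-representation. (Then $X_{\mathrm{con}}(\mathcal G)$ and $X_{\mathrm{res}}(\mathcal G)$ are shift-invariant Borel sets.) $\mathcal M_\sigma(X)$ is the set of $\sigma$-invariant Borel probability measures on $X$, $h_\mu(\sigma)$ is Kolmogorov–Sinai entropy (natural logarithm), $h_{\mathrm{top}}(X)=\sup_{\mu\in\mathcal M_\sigma(X)}h_\mu(\sigma)$, and $C(X)$ is the space of continuous functions $X\to\mathbb R$ with the uniform norm. For $\varphi\in C(X)$, with $X=X(\mathcal G)$, \[ P_X(\varphi)=\sup_{\mu\in\mathcal M_\sigma(X)}\Bigl(h_\mu(\sigma)+\int\varphi\,d\mu\Bigr), \] and $P_{\rm seq}(\varphi,\mathcal G)$, respectively $P_{\rm res}(\varphi,\mathcal G)$, is the same supremum restricted to those $\mu\in\mathcal M_\sigma(X)$ with $\mu(X_{\mathrm{con}}(\mathcal G))=1$, respectively $\mu(X_{\mathrm{res}}(\mathcal G))=1$; the supremum of an empty class is $-\infty$. $\operatorname{FSP}(X,\mathcal G)=\{\varphi\in C(X):P_X(\varphi)=P_{\rm seq}(\varphi,\mathcal G)\}$; $\operatorname{SSP}(X,\mathcal G)=\{\varphi\in C(X):P_{\rm seq}(\varphi,\mathcal G)>P_{\rm res}(\varphi,\mathcal G)\}$; $\operatorname{FSSP}(X,\mathcal G)$ is the closure of $\operatorname{SSP}(X,\mathcal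 G)$ in $C(X)$ in the uniform norm. *)

theory Defs
  imports "HOL-Analysis.Analysis" "HOL-Probability.Probability_Measure"
begin

section \<open>The alphabet\<close>

datatype sign = Plus | Minus

instance sign :: finite
proof
  have "UNIV = {Plus, Minus}" using sign.exhaust by auto
  then show "finite (UNIV :: sign set)" by (metis finite.emptyI finite_insert)
qed

instantiation sign :: discrete_topology
begin

definition open_sign :: "sign set \<Rightarrow> bool" where "open_sign U \<longleftrightarrow> True"

instance by standard (auto simp: open_sign_def)

end

section \<open>Coded shifts\<close>

text \<open>
  Bi-infinite sequences over an alphabet are functions \<open>int \<Rightarrow> 'a\<close>. The type class topology
  on this function type is the product topology, and the alphabet carries the discrete topology.
\<close>

definition shift :: "(int \<Rightarrow> 'a) \<Rightarrow> int \<Rightarrow> 'a" where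
  "shift x = (\<lambda>i. x (i + 1))"

text \<open>
  The coordinate at which the word \<open>g j\<close> starts in the concatenation
  \<open>\<dots> g (-1) . g 0 g 1 \<dots>\<close>. For every \<open>j\<close> at least one of the two sums is empty.
\<close>

definition start_pos :: "(int \<Rightarrow> 'a list) \<Rightarrow> int \<Rightarrow> int" where
  "start_pos g j = (\<Sum>i\<in>{0..<j}. int (length (g i))) - (\<Sum>i\<in>{j..<0}. int (length (g i)))"

definition biconcat :: "(int \<Rightarrow> 'a list) \<Rightarrow> int \<Rightarrow> 'a" where
  "biconcat g n = (THE a. \<exists>j i. i < length (g j) \<and> n = start_pos g j + int i \<and> a = g j ! i)"

definition pointed_rep :: "'a list set \<Rightarrow> (int \<Rightarrow> 'a) \<Rightarrow> (int \<Rightarrow> 'a list) \<times> nat \<Rightarrow> bool" where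
  "pointed_rep G x = (\<lambda>(g, k). (\<forall>j. g j \<in> G) \<and> k < length (g 0) \<and> x = (shift ^^ k) (biconcat g))"

definition X_con :: "'a list set \<Rightarrow> (int \<Rightarrow> 'a) set" where
  "X_con G = {x. \<exists>g k. pointed_rep G x (g, k)}"

definition coded_shift :: "'a::{finite,discrete_topology} list set \<Rightarrow> (int \<Rightarrow> 'a) set" where
  "coded_shift G = closure (X_con G)"

definition X_res :: "'a::{finite,discrete_topology} list set \<Rightarrow> (int \<Rightarrow> 'a) set" where
  "X_res G = coded_shift G - X_con G"

definition uniquely_represents :: "'a list set \<Rightarrow> bool" where
  "uniquely_represents G \<longleftrightarrow> (\<forall>x\<in>X_con G. \<exists>!r. pointed_rep G x r)"

text \<open>
  The description in \<^const>\<open>biconcat\<close> determines a unique letter at every coordinate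
  once all words are nonempty.
\<close>

lemma start_pos_0 [simp]: "start_pos g 0 = 0"
  by (simp add: start_pos_def)

lemma start_pos_Suc: "start_pos g (j + 1) = start_pos g j + int (length (g j))"
proof (cases "j \<ge> 0")
  case True
  then have "{0..<j + 1} = insert j {0..<j}" by auto
  with True show ?thesis by (simp add: start_pos_def)
next
  case False
  then have "{j..<0} = insert j {j + 1..<0}" by auto
  with False show ?thesis by (simp add: start_pos_def)
qed

lemma start_pos_mono:
  assumes "j < j'" shows "start_pos g j + int (length (g j)) \<le> start_pos g j'"
proof -
  have "j + 1 \<le> j'" using assms by simp
  then show ?thesis
  proof (induction j' rule: int_ge_induct)
    case base
    then show ?case by (simp add: start_pos_Suc)
  next
    case (step i)
    then show ?case using start_pos_Suc[of g i] by linarith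
  qed
qed

lemma biconcat_nth:
  assumes "i < length (g j)"
  shows "biconcat g (start_pos g j + int i) = g j ! i"
  unfolding biconcat_def
proof (rule the_equality)
  show "\<exists>j' i'. i' < length (g j') \<and> start_pos g j + int i = start_pos g j' + int i' \<and>
      g j ! i = g j' ! i'"
    using assms by blast
next
  fix a assume "\<exists>j' i'. i' < length (g j') \<and> start_pos g j + int i = start_pos g j' + int i' \<and>
      a = g j' ! i'"
  then obtain j' i' where *: "i' < length (g j')"
      "start_pos g j + int i = start_pos g j' + int i'" "a = g j' ! i'" by blast
  have "j = j'"
  proof (rule linorder_cases[of j j'])
    assume "j < j'"
    from start_pos_mono[OF this, of g] show ?thesis using * assms by linarith
  next
    assume "j' < j"
    from start_pos_mono[OF this, of g] show ?thesis using * assms by linarith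
  qed
  with * show "a = g j ! i" by simp
qed

lemma start_pos_cover:
  assumes "\<And>j. g j \<noteq> []"
  shows "\<exists>j i. i < length (g j) \<and> n = start_pos g j + int i"
proof -
  have pos: "int (length (g j)) \<ge> 1" for j
    using assms[of j] by (cases "g j") auto
  have down: "start_pos g (- int m) \<le> - int m" for m
  proof (induction m)
    case (Suc m)
    have "- int m = - int (Suc m) + 1" by simp
    then show ?case
      using start_pos_Suc[of g "- int (Suc m)"] pos[of "- int (Suc m)"] Suc by simp
  qed simp
  have "start_pos g (- int (nat (- n))) \<le> n"
    using down[of "nat (- n)"] start_pos_mono[of "- int (nat (- n))" 0 g] by (cases "n \<ge> 0") auto
  then obtain j0 where j0: "start_pos g j0 \<le> n" by blast
  have up: "start_pos g j0 + int m \<le> start_pos g (j0 + int m)" for m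
  proof (induction m)
    case (Suc m)
    then show ?case
      using start_pos_Suc[of g "j0 + int m"] pos[of "j0 + int m"] by (simp add: algebra_simps)
  qed simp
  define m where "m = (LEAST m. n < start_pos g (j0 + int m))"
  have ex: "\<exists>m. n < start_pos g (j0 + int m)"
    using up[of "nat (n - start_pos g j0 + 1)"] j0 by (intro exI[of _ "nat (n - start_pos g j0 + 1)"]) auto
  have m: "n < start_pos g (j0 + int m)" unfolding m_def using ex by (rule LeastI_ex)
  then obtain l where l: "m = Suc l" using j0 by (cases m) auto
  have l1: "start_pos g (j0 + int l) \<le> n"
    using not_less_Least[of l "\<lambda>m. n < start_pos g (j0 + int m)"] l unfolding m_def by simp
  have "n < start_pos g (j0 + int l) + int (length (g (j0 + int l)))"
    using m start_pos_Suc[of g "j0 + int l"] l by (simp add: algebra_simps)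
  with l1 show ?thesis
    by (intro exI[of _ "j0 + int l"] exI[of _ "nat (n - start_pos g (j0 + int l))"]) auto
qed

section \<open>Kolmogorov--Sinai entropy\<close>

definition finite_partition :: "'b measure \<Rightarrow> 'b set set \<Rightarrow> bool" where
  "finite_partition M P \<longleftrightarrow> finite P \<and> P \<subseteq> sets M \<and> partition_on (space M) P"

text \<open>Natural logarithm; the convention \<open>0 ln 0 = 0\<close> holds automatically.\<close>

definition partition_entropy :: "'b measure \<Rightarrow> 'b set set \<Rightarrow> real" where
  "partition_entropy M P = - (\<Sum>A\<in>P. measure M A * ln (measure M A))"

definition partition_join :: "'b set set \<Rightarrow> 'b set set \<Rightarrow> 'b set set" where
  "partition_join P Q = {A \<inter> B | A B. A \<in> P \<and> B \<in> Q} - {{}}"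

definition partition_preimage :: "'b measure \<Rightarrow> ('b \<Rightarrow> 'b) \<Rightarrow> 'b set set \<Rightarrow> 'b set set" where
  "partition_preimage M T P = {T -` A \<inter> space M | A. A \<in> P} - {{}}"

text \<open>The join of the preimages of \<open>P\<close> under \<open>T ^^ i\<close> for \<open>i < n\<close>.\<close>

primrec iterated_join :: "'b measure \<Rightarrow> ('b \<Rightarrow> 'b) \<Rightarrow> 'b set set \<Rightarrow> nat \<Rightarrow> 'b set set" where
  "iterated_join M T P 0 = {space M}"
| "iterated_join M T P (Suc n) =
     partition_join (iterated_join M T P n) (partition_preimage M (T ^^ n) P)"

definition ks_entropy_partition :: "'b measure \<Rightarrow> ('b \<Rightarrow> 'b) \<Rightarrow> 'b set set \<Rightarrow> real" where
  "ks_entropy_partition M T P = lim (\<lambda>n. partition_entropy M (iterated_join M T P n) / real n)"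

definition ks_entropy :: "'b measure \<Rightarrow> ('b \<Rightarrow> 'b) \<Rightarrow> ereal" where
  "ks_entropy M T = (SUP P\<in>{P. finite_partition M P}. ereal (ks_entropy_partition M T P))"

section \<open>Invariant measures and pressure\<close>

definition invariant_measures ::
  "(int \<Rightarrow> 'a::{finite,discrete_topology}) set \<Rightarrow> (int \<Rightarrow> 'a) measure set" where
  "invariant_measures X = {M. sets M = sets (restrict_space borel X) \<and> prob_space M \<and>
     shift \<in> M \<rightarrow>\<^sub>M M \<and> distr M M shift = M}"

definition h_top :: "(int \<Rightarrow> 'a::{finite,discrete_topology}) set \<Rightarrow> ereal" where
  "h_top X = (SUP M\<in>invariant_measures X. ks_entropy M shift)"

text \<open>
  Suprema are taken in \<^typ>\<open>ereal\<close>, so that the supremum over an empty class is \<open>-\<infinity>\<close>.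
\<close>

definition pressure_over ::
  "(int \<Rightarrow> 'a) measure set \<Rightarrow> ((int \<Rightarrow> 'a) \<Rightarrow> real) \<Rightarrow> ereal" where
  "pressure_over K \<phi> = (SUP M\<in>K. ks_entropy M shift + ereal (integral\<^sup>L M \<phi>))"

definition P_top ::
  "(int \<Rightarrow> 'a::{finite,discrete_topology}) set \<Rightarrow> ((int \<Rightarrow> 'a) \<Rightarrow> real) \<Rightarrow> ereal" where
  "P_top X \<phi> = pressure_over (invariant_measures X) \<phi>"

definition P_seq ::
  "((int \<Rightarrow> 'a::{finite,discrete_topology}) \<Rightarrow> real) \<Rightarrow> 'a list set \<Rightarrow> ereal" where
  "P_seq \<phi> G =
     pressure_over {M \<in> invariant_measures (coded_shift G). emeasure M (X_con G) = 1} \<phi>"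

definition P_res ::
  "((int \<Rightarrow> 'a::{finite,discrete_topology}) \<Rightarrow> real) \<Rightarrow> 'a list set \<Rightarrow> ereal" where
  "P_res \<phi> G =
     pressure_over {M \<in> invariant_measures (coded_shift G). emeasure M (X_res G) = 1} \<phi>"

section \<open>Spaces of potentials\<close>

text \<open>
  Functions on \<open>X\<close> are represented extensionally, as in \<^const>\<open>cfunspace\<close>, which supplies the
  uniform metric. Since coded shifts are compact, its boundedness condition is automatic there;
  see \<open>mspace_cfunspace_coded_shift\<close> below.
\<close>

definition C_space :: "'b::topological_space set \<Rightarrow> ('b \<Rightarrow> real) set" where
  "C_space X = {\<phi> \<in> extensional X. continuous_on X \<phi>}"

definition FSP :: "'a::{finite,discrete_topology} list set \<Rightarrow> ((int \<Rightarrow> 'a) \<Rightarrow> real) set" where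
  "FSP G = {\<phi> \<in> C_space (coded_shift G). P_top (coded_shift G) \<phi> = P_seq \<phi> G}"

definition SSP :: "'a::{finite,discrete_topology} list set \<Rightarrow> ((int \<Rightarrow> 'a) \<Rightarrow> real) set" where
  "SSP G = {\<phi> \<in> C_space (coded_shift G). P_seq \<phi> G > P_res \<phi> G}"

definition FSSP :: "'a::{finite,discrete_topology} list set \<Rightarrow> ((int \<Rightarrow> 'a) \<Rightarrow> real) set" where
  "FSSP G =
     mtopology_of (cfunspace (top_of_set (coded_shift G)) euclidean_metric) closure_of SSP G"

lemma compact_coded_shift: "compact (coded_shift G)"
proof -
  have "compact (UNIV :: 'a set)" by (simp add: finite_imp_compact)
  then have "compact_space (euclidean :: 'a topology)" by (simp add: compact_space_def)
  then have "compact_space (product_topology (\<lambda>_::int. euclidean :: 'a topology) UNIV)"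
    by (simp add: compact_space_product_topology)
  then have "compact (UNIV :: (int \<Rightarrow> 'a) set)"
    by (simp add: euclidean_product_topology compact_space_def)
  moreover have "closed (coded_shift G)" by (simp add: coded_shift_def)
  ultimately show ?thesis using compact_Int_closed[of UNIV "coded_shift G"] by simp
qed

lemma mspace_cfunspace_coded_shift:
  "mspace (cfunspace (top_of_set (coded_shift G)) euclidean_metric) = C_space (coded_shift G)"
proof -
  have "bounded (\<phi> ` coded_shift G)" if "continuous_on (coded_shift G) \<phi>" for \<phi> :: "_ \<Rightarrow> real"
    using compact_continuous_image[OF that compact_coded_shift] compact_imp_bounded by blast
  then show ?thesis by (auto simp: C_space_def)
qed

end

theory Submission
  imports Defs "HOL-Probability.Information" "HOL-Probability.Infinite_Product_Measure"
    "HOL-Real_Asymp.Real_Asymp"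
begin

text \<open>
  Take for \<open>G\<close> the primitive Dyck words, reading the letters as steps of a walk. In a
  concatenation of such words the boundaries are exactly the times at which the walk attains its
  minimum, so the representation is unique.

  To compare suprema, replace an invariant measure by independent blocks of length \<open>n\<close> with Gibbs
  weights; by the Kolmogorov--Sinai theorem and Gibbs' inequality this loses nothing in the limit.
  Either the words of nonnegative sum or those of negative sum carry half of the partition
  function. Appending one letter to each word of that half makes all block sums have the same
  strict sign: the walk then has a drift, has no minimum, and every concatenation is residual.

  Blocks that are themselves Dyck words give measures on the concatenation set. Padding a
  concatenation of \<open>n\<close> balanced words of length \<open>2 n\<close> with about \<open>2 n\<close> steps up in front and
  as many down at the end yields such words at negligible cost, so entropy \<open>ln 2\<close> is approached.
\<close>

section \<open>Entropy of simple random variables\<close>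

text \<open>The fair-coin measure, the only invariant measure of entropy \<open>ln 2\<close>, has an
  oscillating walk that almost surely has no minimum, so it lives on the residual set. On the
  concatenation set the value \<open>ln 2\<close> can therefore only be approached, and block
  measures of growing length are natural there. For a general potential nothing is known about the
  drift of a near-optimal measure, so a drift is imposed by hand. One extra letter per block costs
  at most the supremum of the potential, which vanishes against the block length. All blocks of one
  measure must drift the same way, since mixed signs could recreate minima; hence the restriction to
  one half of the words.

  Entropy is a supremum over all finite partitions, whereas these estimates only see words. The
  transfer rests on two properties of Shannon entropy: monotonicity under functions and
  subadditivity for pairs.\<close>

lemma fekete:
  fixes a :: "nat \<Rightarrow> real"
  assumes nonneg: "\<And>n. 0 \<le> a n" and sub: "\<And>m n. a (m + n) \<le> a m + a n"
  obtains l where "(\<lambda>n. a n / real n) \<longlonglongrightarrow> l" "\<And>n. 0 < n \<Longrightarrow> l \<le> a n / real n"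
proof -
  define l where "l = (INF n\<in>{0<..}. a n / real n)"
  have bdd: "bdd_below ((\<lambda>n. a n / real n) ` {0<..})"
    by (rule bdd_belowI[where m = 0]) (auto simp: nonneg)
  have le: "l \<le> a n / real n" if "0 < n" for n
    unfolding l_def using that by (intro cINF_lower[OF bdd]) auto
  have mult: "a (q * k + r) \<le> real q * a k + a r" for q k r
  proof (induction q)
    case (Suc q)
    then show ?case using sub[of k "q * k + r"] by (simp add: algebra_simps)
  qed simp
  have "(\<lambda>n. a n / real n) \<longlonglongrightarrow> l"
  proof (rule LIMSEQ_I)
    fix e :: real assume "0 < e"
    have "\<exists>k\<in>{0<..}. a k / real k < l + e / 2"
      using cINF_less_iff[OF _ bdd, of "l + e / 2"] \<open>0 < e\<close> unfolding l_def by auto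
    then obtain k where k: "0 < k" "a k / real k < l + e / 2" by auto
    define C where "C = Max (a ` {..k})"
    have C: "a r \<le> C" if "r \<le> k" for r unfolding C_def using that by (intro Max_ge) auto
    have C0: "0 \<le> C" using C[of 0] nonneg[of 0] by linarith
    obtain N where N: "real N > 2 * C / e" using reals_Archimedean2 by blast
    show "\<exists>no. \<forall>n\<ge>no. norm (a n / real n - l) < e"
    proof (intro exI allI impI)
      fix n assume n: "n \<ge> Suc N"
      then have n0: "0 < real n" by simp
      \<comment> \<open>Division with remainder leaves \<open>n div k\<close> copies of the nearly
        optimal \<open>a k\<close> and a remainder bounded by \<open>C\<close>, which disappears
        after division by \<open>n\<close>.\<close>
      have "a n \<le> real (n div k) * a k + a (n mod k)"
        using mult[of "n div k" k "n mod k"] by simp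
      also have "a (n mod k) \<le> C" using k by (intro C) (simp add: less_imp_le)
      also have "real (n div k) * a k \<le> (real n / real k) * a k"
        using nonneg k by (intro mult_right_mono) (simp_all add: of_nat_div_le_of_nat)
      finally have "a n / real n \<le> (real n / real k * a k + C) / real n"
        using n0 by (intro divide_right_mono) auto
      also have "\<dots> = a k / real k + C / real n" using n0 by (simp add: field_simps)
      also have "C / real n < e / 2"
      proof -
        have "2 * C / e < real n" using N n by linarith
        then show ?thesis using \<open>0 < e\<close> n0 by (simp add: field_simps)
      qed
      finally have "a n / real n < l + e" using k by linarith
      moreover have "l \<le> a n / real n" using n by (intro le) simp
      ultimately show "norm (a n / real n - l) < e" by simp
    qed
  qed
  then show ?thesis using that le by blast
qed

section \<open>Shannon entropy of functions, and partitions as level sets\<close>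

text \<open>Entropy is attached to functions rather than partitions: joins become tuples, coarsening
  becomes composition, and the inequalities for simple random variables apply.\<close>

definition ent :: "'a measure \<Rightarrow> ('a \<Rightarrow> 'b) \<Rightarrow> real" where
  "ent M X = - (\<Sum>v\<in>X ` space M.
     measure M (X -` {v} \<inter> space M) * ln (measure M (X -` {v} \<inter> space M)))"

definition fibers :: "'a measure \<Rightarrow> ('a \<Rightarrow> 'b) \<Rightarrow> 'a set set" where
  "fibers M X = (\<lambda>v. X -` {v} \<inter> space M) ` (X ` space M)"

lemma mem_fibers_iff: "A \<in> fibers M X \<longleftrightarrow> (\<exists>x\<in>space M. A = {y \<in> space M. X y = X x})"
  by (auto simp: fibers_def vimage_def)

lemma partition_entropy_fibers: "partition_entropy M (fibers M X) = ent M X"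
proof -
  have "inj_on (\<lambda>v. X -` {v} \<inter> space M) (X ` space M)" by (rule inj_onI) auto
  then show ?thesis
    by (simp add: partition_entropy_def ent_def fibers_def sum.reindex)
qed

text \<open>Sending a point to its cell realises any partition by level sets, so statements about
  functions cover the arbitrary finite partitions in \<open>ks_entropy\<close>.\<close>

lemma fibers_partition:
  assumes "partition_on (space M) P"
  shows "fibers M (\<lambda>x. THE A. A \<in> P \<and> x \<in> A) = P"
proof -
  let ?f = "\<lambda>x. THE A. A \<in> P \<and> x \<in> A"
  have U: "\<Union>P = space M" and disj: "disjoint P" and ne: "{} \<notin> P"
    using assms by (auto simp: partition_on_def)
  have f: "?f x = A" if "A \<in> P" "x \<in> A" for A x
    using that disj by (intro the_equality) (auto simp: disjoint_def)
  have fib: "{y \<in> space M. ?f y = ?f x} = A" if A: "A \<in> P" "x \<in> A" for A x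
  proof (intro set_eqI iffI)
    fix y assume "y \<in> {y \<in> space M. ?f y = ?f x}"
    then have y: "y \<in> space M" "?f y = ?f x" by auto
    from y(1) U obtain B where B: "B \<in> P" "y \<in> B" by blast
    with f[OF B] f[OF A] y(2) show "y \<in> A" by simp
  next
    fix y assume "y \<in> A"
    with f[OF A(1) this] f[OF A] A U show "y \<in> {y \<in> space M. ?f y = ?f x}" by auto
  qed
  show ?thesis
  proof (intro set_eqI iffI)
    fix A assume "A \<in> fibers M ?f"
    then obtain x where x: "x \<in> space M" "A = {y \<in> space M. ?f y = ?f x}"
      unfolding mem_fibers_iff by blast
    from x(1) U obtain B where B: "B \<in> P" "x \<in> B" by blast
    from fib[OF B] x(2) B(1) show "A \<in> P" by simp
  next
    fix A assume A: "A \<in> P"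
    then obtain x where x: "x \<in> A" using ne by (cases "A = {}") auto
    with fib[OF A x] A U show "A \<in> fibers M ?f" unfolding mem_fibers_iff by (intro bexI[of _ x]) auto
  qed
qed

definition itinerary :: "('a \<Rightarrow> 'a) \<Rightarrow> ('a \<Rightarrow> 'b) \<Rightarrow> nat \<Rightarrow> 'a \<Rightarrow> 'b list" where
  "itinerary T f n x = map (\<lambda>i. f ((T ^^ i) x)) [0..<n]"

lemma itinerary_add: "itinerary T f (m + n) x = itinerary T f m x @ itinerary T f n ((T ^^ m) x)"
proof -
  have "map (\<lambda>i. f ((T ^^ i) x)) [m..<m+n] = map (\<lambda>i. f ((T ^^ i) ((T ^^ m) x))) [0..<n]"
    by (rule nth_equalityI) (simp_all add: funpow_add[symmetric, THEN fun_cong, unfolded comp_def] add.commute)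
  then show ?thesis by (simp add: itinerary_def upt_add_eq_append[of 0 m n])
qed

lemma itinerary_Suc: "itinerary T f (Suc n) x = itinerary T f n x @ [f ((T ^^ n) x)]"
  by (simp add: itinerary_def)

text \<open>A cell of the \<open>n\<close>-fold join is the set of points with a common itinerary.
  Level sets over attained values are nonempty, which matches the removal of \<open>{}\<close> in
  the joins; at \<open>n = 0\<close> the join is \<open>{space M}\<close>, hence the assumption of a
  nonempty space.\<close>

lemma iterated_join_fibers:
  assumes T: "T \<in> space M \<rightarrow> space M" and ne: "space M \<noteq> {}"
  shows "iterated_join M T (fibers M f) n = fibers M (itinerary T f n)"
proof (induction n)
  case 0
  show ?case using ne by (auto simp: fibers_def itinerary_def)
next
  case (Suc n)
  have Tn: "(T ^^ n) x \<in> space M" if "x \<in> space M" for x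
    using that T by (induction n) auto
  have pre: "partition_preimage M (T ^^ n) (fibers M f) = fibers M (\<lambda>x. f ((T ^^ n) x))"
  proof (intro set_eqI iffI)
    fix B assume "B \<in> partition_preimage M (T ^^ n) (fibers M f)"
    then obtain x where x: "x \<in> space M" "B = (T ^^ n) -` {y \<in> space M. f y = f x} \<inter> space M" "B \<noteq> {}"
      unfolding partition_preimage_def mem_fibers_iff by blast
    then obtain z where "z \<in> B" by blast
    then show "B \<in> fibers M (\<lambda>x. f ((T ^^ n) x))"
      unfolding mem_fibers_iff x(2) using Tn by (intro bexI[of _ z]) auto
  next
    fix B assume "B \<in> fibers M (\<lambda>x. f ((T ^^ n) x))"
    then obtain x where x: "x \<in> space M" "B = {y \<in> space M. f ((T ^^ n) y) = f ((T ^^ n) x)}"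
      unfolding mem_fibers_iff by blast
    then have "B = (T ^^ n) -` {y \<in> space M. f y = f ((T ^^ n) x)} \<inter> space M" "B \<noteq> {}"
      using Tn by auto
    moreover have "{y \<in> space M. f y = f ((T ^^ n) x)} \<in> fibers M f"
      unfolding mem_fibers_iff using Tn x(1) by blast
    ultimately show "B \<in> partition_preimage M (T ^^ n) (fibers M f)"
      unfolding partition_preimage_def by blast
  qed
  have join: "partition_join (fibers M F) (fibers M G) = fibers M (\<lambda>x. F x @ [G x])"
    for F :: "_ \<Rightarrow> 'c list" and G
  proof (intro set_eqI iffI)
    fix B assume "B \<in> partition_join (fibers M F) (fibers M G)"
    then obtain x y where x: "x \<in> space M" "y \<in> space M"
        "B = {z \<in> space M. F z = F x} \<inter> {z \<in> space M. G z = G y}" "B \<noteq> {}"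
      unfolding partition_join_def mem_fibers_iff by blast
    then obtain z where "z \<in> B" by blast
    then show "B \<in> fibers M (\<lambda>x. F x @ [G x])"
      unfolding mem_fibers_iff x(3) by (intro bexI[of _ z]) auto
  next
    fix B assume "B \<in> fibers M (\<lambda>x. F x @ [G x])"
    then obtain x where x: "x \<in> space M" "B = {y \<in> space M. F y @ [G y] = F x @ [G x]}"
      unfolding mem_fibers_iff by blast
    then have "B = {z \<in> space M. F z = F x} \<inter> {z \<in> space M. G z = G x}" "B \<noteq> {}" by auto
    with x(1) show "B \<in> partition_join (fibers M F) (fibers M G)"
      unfolding partition_join_def mem_fibers_iff by blast
  qed
  show ?case by (simp add: Suc.IH pre join itinerary_Suc[abs_def])
qed

context prob_space
begin

text \<open>Base \<open>exp 1\<close> makes the logarithm natural, so that the inequalities of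
  \<open>information_space\<close> transfer to \<open>ent\<close>.\<close>

lemma entropy_eq_ent:
  assumes "simple_function M X"
  shows "entropy (exp 1) (count_space (X ` space M)) X = ent M X"
proof -
  interpret information_space M "exp 1" by unfold_locales simp
  show ?thesis
    by (simp add: entropy_simple_distributed[OF simple_distributedI[OF assms measure_nonneg refl]]
        ent_def log_def)
qed

lemma ent_cong: "(\<And>x. x \<in> space M \<Longrightarrow> X x = Y x) \<Longrightarrow> ent M X = ent M Y"
  unfolding ent_def
  by (intro arg_cong[where f = uminus] sum.cong) (auto intro!: arg_cong2[where f="(*)"] arg_cong[where f=ln] arg_cong[where f=prob])

lemma ent_le:
  assumes X: "simple_function M X" and Y: "\<And>x. x \<in> space M \<Longrightarrow> Y x = f (X x)"
  shows "ent M Y \<le> ent M X"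
proof -
  interpret information_space M "exp 1" by unfold_locales simp
  have "ent M Y = ent M (f \<circ> X)" using Y by (intro ent_cong) simp
  also have "\<dots> \<le> ent M X"
    using entropy_data_processing[OF X, of f] entropy_eq_ent[OF X]
      entropy_eq_ent[OF simple_function_compose[OF X, of f]] by simp
  finally show ?thesis .
qed

text \<open>The chain rule is combined with the fact that conditioning does not increase
  entropy.\<close>

lemma ent_Pair_le:
  assumes X: "simple_function M X" and Y: "simple_function M Y"
  shows "ent M (\<lambda>x. (X x, Y x)) \<le> ent M X + ent M Y"
proof -
  interpret information_space M "exp 1" by unfold_locales simp
  have XY: "simple_function M (\<lambda>x. (X x, Y x))" using X Y by (rule simple_function_Pair)
  show ?thesis
    using entropy_chain_rule[OF X Y] conditional_entropy_less_eq_entropy[OF Y X]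
      entropy_eq_ent[OF X] entropy_eq_ent[OF Y] entropy_eq_ent[OF XY] by linarith
qed

lemma ent_le_ln_card:
  assumes X: "simple_function M X"
  shows "ent M X \<le> ln (real (card (X ` space M)))"
proof -
  interpret information_space M "exp 1" by unfold_locales simp
  show ?thesis
    using entropy_le_card[OF simple_distributedI[OF X measure_nonneg refl]]
    by (simp add: entropy_eq_ent[OF X] log_def)
qed

lemma ent_nonneg: "0 \<le> ent M X"
proof -
  have "p * ln p \<le> 0" if "p = prob A" for p A
    using that by (cases "p = 0") (auto simp: mult_le_0_iff zero_less_measure_iff measure_le_0_iff)
  then show ?thesis unfolding ent_def by (auto intro!: sum_nonpos)
qed

end

text \<open>Values that are not attained contribute 0, so the sum may run over any convenient finite
  superset of the range, such as all words of a given length.\<close>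

lemma ent_eq_sum:
  assumes "finite S" "X ` space M \<subseteq> S"
  shows "ent M X = - (\<Sum>v\<in>S. measure M (X -` {v} \<inter> space M) * ln (measure M (X -` {v} \<inter> space M)))"
proof -
  have "X -` {v} \<inter> space M = {}" if "v \<notin> X ` space M" for v using that by auto
  then show ?thesis unfolding ent_def using assms
    by (intro arg_cong[where f = uminus] sum.mono_neutral_left) auto
qed

lemma ent_distr:
  assumes T: "T \<in> M \<rightarrow>\<^sub>M N" and X: "simple_function N X"
  shows "ent (distr M N T) X = ent M (X \<circ> T)"
proof -
  have fin: "finite (X ` space N)" using X by (simp add: simple_function_def)
  have "T ` space M \<subseteq> space N" using measurable_space[OF T] by auto
  then have sub: "(X \<circ> T) ` space M \<subseteq> X ` space N" by auto
  have "measure (distr M N T) (X -` {v} \<inter> space N) = measure M ((X \<circ> T) -` {v} \<inter> space M)" for v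
  proof -
    have "X -` {v} \<inter> space N \<in> sets N" using X by (rule simple_functionD)
    then have "measure (distr M N T) (X -` {v} \<inter> space N)
      = measure M (T -` (X -` {v} \<inter> space N) \<inter> space M)" using T by (intro measure_distr)
    also have "T -` (X -` {v} \<inter> space N) \<inter> space M = (X \<circ> T) -` {v} \<inter> space M"
      using measurable_space[OF T] by auto
    finally show ?thesis .
  qed
  then have "ent (distr M N T) X = - (\<Sum>v\<in>X ` space N.
      measure M ((X \<circ> T) -` {v} \<inter> space M) * ln (measure M ((X \<circ> T) -` {v} \<inter> space M)))"
    by (simp add: ent_def)
  also have "\<dots> = ent M (X \<circ> T)" by (rule ent_eq_sum[OF fin sub, symmetric])
  finally show ?thesis .
qed

lemma simple_function_compose_measurable:
  assumes "T \<in> M \<rightarrow>\<^sub>M N" "simple_function N f"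
  shows "simple_function M (\<lambda>x. f (T x))"
proof -
  have "(\<lambda>x. f (T x)) ` space M \<subseteq> f ` space N" using measurable_space[OF assms(1)] by auto
  then have 1: "finite ((\<lambda>x. f (T x)) ` space M)"
    using assms(2) finite_subset unfolding simple_function_def by blast
  have "(\<lambda>x. f (T x)) -` {v} \<inter> space M \<in> sets M" for v
  proof -
    have "f -` {v} \<inter> space N \<in> sets N" using assms(2) by (rule simple_functionD)
    from measurable_sets[OF assms(1) this]
    have "T -` (f -` {v} \<inter> space N) \<inter> space M \<in> sets M" .
    also have "T -` (f -` {v} \<inter> space N) \<inter> space M = (\<lambda>x. f (T x)) -` {v} \<inter> space M"
      using measurable_space[OF assms(1)] by auto
    finally show ?thesis .
  qed
  with 1 show ?thesis by (simp add: simple_function_def)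
qed

lemma simple_function_map_upt:
  assumes "\<And>i. i < n \<Longrightarrow> simple_function M (f i)"
  shows "simple_function M (\<lambda>x. map (\<lambda>i. f i x) [0..<n])"
  using assms
proof (induction n)
  case (Suc n)
  then show ?case
    using simple_function_compose[OF simple_function_Pair[of M "\<lambda>x. map (\<lambda>i. f i x) [0..<n]" "f n"],
        of "\<lambda>(u, v). u @ [v]"] by (simp add: comp_def)
qed simp

section \<open>Measure-preserving maps and the entropy rate of itineraries\<close>

locale measure_preserving = prob_space M for M :: "'a measure" +
  fixes T :: "'a \<Rightarrow> 'a"
  assumes T_measurable: "T \<in> M \<rightarrow>\<^sub>M M" and distr_T: "distr M M T = M"
begin

lemma funpow_measurable: "(T ^^ n) \<in> M \<rightarrow>\<^sub>M M"
  by (induction n) (use T_measurable in \<open>auto simp: comp_def id_def\<close>)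

lemma distr_funpow: "distr M M (T ^^ n) = M"
proof (induction n)
  case 0 then show ?case by (simp add: id_def)
next
  case (Suc n)
  have "distr M M (T ^^ Suc n) = distr (distr M M (T ^^ n)) M T"
    unfolding distr_distr[OF T_measurable funpow_measurable] by simp
  then show ?case unfolding Suc distr_T .
qed

lemma simple_itinerary:
  assumes "simple_function M f" shows "simple_function M (itinerary T f n)"
  unfolding itinerary_def[abs_def]
  by (intro simple_function_map_upt simple_function_compose_measurable[OF funpow_measurable assms])

text \<open>An itinerary splits at time \<open>m\<close>; its second part has the law of an
  itinerary of length \<open>n\<close>, because \<open>T ^^ m\<close> preserves the measure.\<close>

lemma ent_itinerary_add:
  assumes f: "simple_function M f"
  shows "ent M (itinerary T f (m + n)) \<le> ent M (itinerary T f m) + ent M (itinerary T f n)"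
proof -
  let ?G = "\<lambda>x. itinerary T f n ((T ^^ m) x)"
  have G: "simple_function M ?G"
    by (rule simple_function_compose_measurable[OF funpow_measurable simple_itinerary[OF f]])
  have "ent M (itinerary T f (m + n)) \<le> ent M (\<lambda>x. (itinerary T f m x, ?G x))"
    by (rule ent_le[OF simple_function_Pair[OF simple_itinerary[OF f] G], where f = "\<lambda>(u, v). u @ v"])
      (simp add: itinerary_add)
  also have "\<dots> \<le> ent M (itinerary T f m) + ent M ?G"
    by (rule ent_Pair_le[OF simple_itinerary[OF f] G])
  also have "ent M ?G = ent M (itinerary T f n)"
    using ent_distr[OF funpow_measurable simple_itinerary[OF f], of m n] by (simp add: distr_funpow comp_def)
  finally show ?thesis .
qed

text \<open>Subadditivity turns the \<open>lim\<close> of the definition into a genuine limit that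
  is also an infimum. The second part, a bound by each finite stage, feeds the upper
  estimates.\<close>

lemma ks_entropy_partition_fibers:
  assumes f: "simple_function M f"
  shows "(\<lambda>n. ent M (itinerary T f n) / real n) \<longlonglongrightarrow> ks_entropy_partition M T (fibers M f)"
    and "0 < n \<Longrightarrow> ks_entropy_partition M T (fibers M f) \<le> ent M (itinerary T f n) / real n"
proof -
  have "iterated_join M T (fibers M f) n = fibers M (itinerary T f n)" for n
    using measurable_space[OF T_measurable] not_empty by (intro iterated_join_fibers) auto
  then have ks: "ks_entropy_partition M T (fibers M f) = lim (\<lambda>n. ent M (itinerary T f n) / real n)"
    by (simp add: ks_entropy_partition_def partition_entropy_fibers)
  obtain l where l: "(\<lambda>n. ent M (itinerary T f n) / real n) \<longlonglongrightarrow> l"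
      "\<And>n. 0 < n \<Longrightarrow> l \<le> ent M (itinerary T f n) / real n"
    using fekete[of "\<lambda>n. ent M (itinerary T f n)"] ent_nonneg ent_itinerary_add[OF f] by blast
  have "ks_entropy_partition M T (fibers M f) = l" unfolding ks using l(1) by (rule limI)
  with l show "(\<lambda>n. ent M (itinerary T f n) / real n) \<longlonglongrightarrow> ks_entropy_partition M T (fibers M f)"
    and "0 < n \<Longrightarrow> ks_entropy_partition M T (fibers M f) \<le> ent M (itinerary T f n) / real n"
    by auto
qed

lemma ent_itinerary_le:
  assumes f: "simple_function M f"
  shows "ent M (itinerary T f n) \<le> real n * ent M f"
proof (induction n)
  case 0
  have "ent M (itinerary T f 0) = 0"
    using not_empty by (auto simp: ent_def itinerary_def prob_space image_constant_conv vimage_def)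
  then show ?case by simp
next
  case (Suc n)
  have "ent M (itinerary T f 1) \<le> ent M f"
    by (rule ent_le[OF f, where f = "\<lambda>v. [v]"]) (simp add: itinerary_def)
  with Suc ent_itinerary_add[OF f, of n 1] show ?case by (simp add: algebra_simps)
qed

end

section \<open>Primitive Dyck words\<close>

fun step :: "sign \<Rightarrow> int" where
  "step Plus = 1"
| "step Minus = - 1"

definition wsum :: "sign list \<Rightarrow> int" where
  "wsum w = sum_list (map step w)"

lemma wsum_simps [simp]:
  "wsum [] = 0" "wsum (a # w) = step a + wsum w" "wsum (u @ v) = wsum u + wsum v"
  "wsum (replicate n a) = int n * step a"
  by (simp_all add: wsum_def sum_list_replicate)

lemma wsum_bounds: "\<bar>wsum w\<bar> \<le> int (length w)"
proof (induction w)
  case (Cons a w)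
  then show ?case by (cases a) auto
qed simp

text \<open>Strict positivity at proper prefixes excludes earlier returns to 0: these are the Dyck
  words that do not split into shorter ones.\<close>

definition dyck :: "sign list set" where
  "dyck = {w. w \<noteq> [] \<and> wsum w = 0 \<and> (\<forall>k. 0 < k \<and> k < length w \<longrightarrow> 0 < wsum (take k w))}"

text \<open>The initial ascent lifts \<open>u\<close> strictly above 0, and the final descent
  reaches 0 only at its end. The strict bound rules out a return to 0 inside \<open>u\<close>, and
  at \<open>k = 0\<close> it forces \<open>0 < a\<close>.\<close>

lemma padded_dyck:
  assumes a: "\<And>k. - int a < wsum (take k u)" and b: "int b = int a + wsum u"
  shows "replicate a Plus @ u @ replicate b Minus \<in> dyck"
  unfolding dyck_def
proof (intro CollectI conjI allI impI)
  have "0 < a" using a[of 0] by simp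
  then show "replicate a Plus @ u @ replicate b Minus \<noteq> []" by auto
  show "wsum (replicate a Plus @ u @ replicate b Minus) = 0" using b by simp
  fix k assume k: "0 < k \<and> k < length (replicate a Plus @ u @ replicate b Minus)"
  show "0 < wsum (take k (replicate a Plus @ u @ replicate b Minus))"
  proof (cases "k \<le> a + length u")
    case True
    then show ?thesis using True k a[of "k - a"] by (cases "k \<le> a") (simp_all add: min_def)
  next
    case False
    then show ?thesis using k b by (simp add: min_def)
  qed
qed

section \<open>The walk of a two-sided sequence\<close>

lemma funpow_shift: "(shift ^^ k) x = (\<lambda>i. x (i + int k))"
  by (induction k) (auto simp: shift_def algebra_simps)

definition word_at :: "(int \<Rightarrow> 'a) \<Rightarrow> int \<Rightarrow> nat \<Rightarrow> 'a list" where
  "word_at x a n = map (\<lambda>i. x (a + int i)) [0..<n]"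

lemma length_word_at [simp]: "length (word_at x a n) = n"
  by (simp add: word_at_def)

lemma nth_word_at [simp]: "i < n \<Longrightarrow> word_at x a n ! i = x (a + int i)"
  by (simp add: word_at_def)

lemma take_word_at: "k \<le> n \<Longrightarrow> take k (word_at x a n) = word_at x a k"
  by (simp add: word_at_def take_map)

lemma word_at_Suc: "word_at x a (Suc n) = word_at x a n @ [x (a + int n)]"
  by (simp add: word_at_def)

text \<open>Height at time \<open>n\<close>, normalised by \<open>walk x 0 = 0\<close>; the second
  sum continues it to negative times, as in \<open>start_pos\<close>.\<close>

definition walk :: "(int \<Rightarrow> sign) \<Rightarrow> int \<Rightarrow> int" where
  "walk x n = (\<Sum>i\<in>{0..<n}. step (x i)) - (\<Sum>i\<in>{n..<0}. step (x i))"

lemma walk_Suc: "walk x (n + 1) = walk x n + step (x n)"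
proof (cases "n \<ge> 0")
  case True
  then have "{0..<n + 1} = insert n {0..<n}" by auto
  with True show ?thesis by (simp add: walk_def)
next
  case False
  then have "{n..<0} = insert n {n + 1..<0}" by auto
  with False show ?thesis by (simp add: walk_def)
qed

lemma walk_add: "walk x (a + int n) = walk x a + wsum (word_at x a n)"
proof (induction n)
  case 0 then show ?case by (simp add: word_at_def)
next
  case (Suc n)
  then show ?case using walk_Suc[of x "a + int n"] by (simp add: word_at_Suc algebra_simps)
qed

definition walk_mins :: "(int \<Rightarrow> sign) \<Rightarrow> int set" where
  "walk_mins x = {t. \<forall>u. walk x t \<le> walk x u}"

text \<open>Along a progression of step \<open>L\<close> the heights are strictly monotone integers,
  hence tend to minus infinity at one of the two ends, whichever the direction.\<close>

lemma no_walk_mins: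
  assumes L: "0 < (L::int)"
    and "(\<forall>j::int. walk x (r + j * L) < walk x (r + (j + 1) * L)) \<or>
      (\<forall>j::int. walk x (r + (j + 1) * L) < walk x (r + j * L))"
  shows "walk_mins x = {}"
proof (rule ccontr)
  assume "walk_mins x \<noteq> {}"
  then obtain t where t: "\<And>u. walk x t \<le> walk x u" by (auto simp: walk_mins_def)
  \<comment> \<open>Each step in the descending direction lowers the height by at least 1, so
    \<open>m\<close> steps lead strictly below the supposed minimum.\<close>
  define m where "m = nat (walk x r - walk x t + 1)"
  have m: "walk x r - int m < walk x t" using t[of r] by (simp add: m_def)
  from assms(2) show False
  proof
    assume inc: "\<forall>j::int. walk x (r + j * L) < walk x (r + (j + 1) * L)"
    have "walk x (r + (- int n) * L) \<le> walk x r - int n" for n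
    proof (induction n)
      case (Suc n)
      have "walk x (r + (- int (Suc n)) * L) < walk x (r + (- int n) * L)"
        using inc[rule_format, of "- int (Suc n)"] by simp
      with Suc show ?case by simp
    qed simp
    from this[of m] m t[of "r + (- int m) * L"] show False by simp
  next
    assume dec: "\<forall>j::int. walk x (r + (j + 1) * L) < walk x (r + j * L)"
    have "walk x (r + int n * L) \<le> walk x r - int n" for n
    proof (induction n)
      case (Suc n)
      then show ?case using dec[rule_format, of "int n"] by (simp add: algebra_simps)
    qed simp
    from this[of m] m t[of "r + int m * L"] show False by simp
  qed
qed

section \<open>Uniqueness of representations from the minima of the walk\<close>

text \<open>The shift by \<open>k\<close> moves the start of the \<open>j\<close>-th word to
  \<open>start_pos g j - k\<close>; hence the words can be read off from \<open>x\<close> once these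
  positions are known.\<close>

lemma pointed_rep_word:
  assumes rep: "pointed_rep G x (g, k)"
  shows "g j = word_at x (start_pos g j - int k) (length (g j))"
proof (rule nth_equalityI)
  fix i assume i: "i < length (g j)"
  have x: "x n = biconcat g (n + int k)" for n
    using rep by (simp add: pointed_rep_def funpow_shift)
  show "g j ! i = word_at x (start_pos g j - int k) (length (g j)) ! i"
    using i biconcat_nth[of i g j, OF i] by (simp add: x)
qed simp

lemma int_all_induct:
  assumes "P (0::int)" "\<And>j. P j \<longleftrightarrow> P (j + 1)"
  shows "P j"
proof (induction j rule: int_induct[where k = 0])
  case (step2 i)
  then show ?case using assms(2)[of "i - 1"] by simp
qed (use assms in auto)

text \<open>Every word returns to its initial height and stays strictly above it in between. All
  boundaries thus share one height and all other times lie higher, so the boundary set depends on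
  \<open>x\<close> alone.\<close>

lemma walk_mins_eq:
  assumes rep: "pointed_rep dyck x (g, k)"
  shows "walk_mins x = range (\<lambda>j. start_pos g j - int k)"
proof -
  define b where "b j = start_pos g j - int k" for j
  have g: "g j \<in> dyck" for j using rep by (simp add: pointed_rep_def)
  have ne: "g j \<noteq> []" for j using g[of j] by (simp add: dyck_def)
  have word: "g j = word_at x (b j) (length (g j))" for j
    unfolding b_def by (rule pointed_rep_word[OF rep])
  have b_Suc: "b (j + 1) = b j + int (length (g j))" for j by (simp add: b_def start_pos_Suc)
  have eq: "walk x (b j + int i) = walk x (b j) + wsum (take i (g j))" if "i \<le> length (g j)" for i j
    using that word[of j] walk_add[of x "b j" i] take_word_at[of i "length (g j)" x "b j"] by simp
  have c: "walk x (b j) = walk x (b 0)" for j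
  proof (rule int_all_induct[where P = "\<lambda>j. walk x (b j) = walk x (b 0)"])
    fix j
    have "walk x (b (j + 1)) = walk x (b j)" using eq[of "length (g j)" j] g[of j]
      by (simp add: b_Suc dyck_def)
    then show "walk x (b j) = walk x (b 0) \<longleftrightarrow> walk x (b (j + 1)) = walk x (b 0)" by simp
  qed simp
  have n: "\<exists>j i. n = b j + int i \<and> i < length (g j)" for n
    using start_pos_cover[of g "n + int k"] ne by (force simp: b_def)
  have ge: "walk x (b 0) \<le> walk x n" and "walk x n = walk x (b 0) \<Longrightarrow> n \<in> range b" for n
  proof -
    obtain j i where ji: "n = b j + int i" "i < length (g j)" using n by blast
    have "walk x n = walk x (b 0) + wsum (take i (g j))" using ji eq[of i j] c[of j] by simp
    moreover have "i = 0 \<or> 0 < wsum (take i (g j))" using g[of j] ji(2) by (auto simp: dyck_def)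
    ultimately show "walk x (b 0) \<le> walk x n" and "walk x n = walk x (b 0) \<Longrightarrow> n \<in> range b"
      using ji(1) by auto
  qed
  note mem = this
  have "walk_mins x = range b"
  proof (intro set_eqI iffI)
    fix n assume "n \<in> walk_mins x"
    then have "walk x n \<le> walk x (b 0)" by (simp add: walk_mins_def)
    with mem(1)[of n] show "n \<in> range b" by (intro mem(2)) simp
  next
    fix n assume "n \<in> range b"
    then obtain j where "n = b j" by blast
    then show "n \<in> walk_mins x" using c[of j] mem(1) by (simp add: walk_mins_def)
  qed
  then show ?thesis by (simp add: b_def[abs_def])
qed

text \<open>Consecutive indices go to consecutive elements of the common range, so agreement
  propagates from index 0 in both directions.\<close>

lemma strict_mono_range_unique:
  fixes f f' :: "int \<Rightarrow> int"
  assumes f: "strict_mono f" and f': "strict_mono f'" and r: "range f = range f'" and "f 0 = f' 0"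
  shows "f j = f' j"
proof -
  have up: "f' (j + 1) \<le> f (j + 1)" if prem: "strict_mono f" "strict_mono f'" "range f = range f'" "f j = f' j"
    for f f' :: "int \<Rightarrow> int" and j
  proof -
    obtain l where l: "f (j + 1) = f' l" using prem(3) by (metis rangeE rangeI)
    have "f' j < f' l" using prem(1,4) l by (metis less_add_one strict_mono_less)
    then have "j + 1 \<le> l" using prem(2) by (simp add: strict_mono_less)
    then show ?thesis using prem(2) l by (simp add: strict_mono_less_eq)
  qed
  have down: "f j \<le> f' j" if prem: "strict_mono f" "strict_mono f'" "range f = range f'" "f (j + 1) = f' (j + 1)"
    for f f' :: "int \<Rightarrow> int" and j
  proof -
    obtain l where l: "f j = f' l" using prem(3) by (metis rangeE rangeI)
    have "f' l < f' (j + 1)" using prem(1,4) l by (metis less_add_one strict_mono_less)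
    then have "l \<le> j" using prem(2) by (simp add: strict_mono_less)
    then show ?thesis using prem(2) l by (simp add: strict_mono_less_eq)
  qed
  show ?thesis
  proof (rule int_all_induct[where P = "\<lambda>j. f j = f' j"])
    show "f 0 = f' 0" by fact
    show "f j = f' j \<longleftrightarrow> f (j + 1) = f' (j + 1)" for j
      using up[of f f' j] up[of f' f j] down[of f f' j] down[of f' f j] f f' r by force
  qed
qed

lemma strict_mono_intI:
  assumes "\<And>j. f j < f (j + 1)"
  shows "strict_mono (f :: int \<Rightarrow> int)"
proof (rule strict_monoI)
  fix i j :: int assume "i < j"
  then have "i + 1 \<le> j" by simp
  then show "f i < f j"
  proof (induction j rule: int_ge_induct)
    case (step j)
    then show ?case using assms[of j] by simp
  qed (rule assms)
qed

text \<open>The minima fix the set of boundaries, and \<open>k < length (g 0)\<close> fixes the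
  numbering: boundary 0 is the last one at or before the origin. The words are what stands between
  consecutive boundaries.\<close>

lemma uniquely_represents_dyck: "uniquely_represents dyck"
  unfolding uniquely_represents_def
proof
  fix x assume "x \<in> X_con dyck"
  then obtain g k where rep: "pointed_rep dyck x (g, k)" by (auto simp: X_con_def)
  have "r = (g, k)" if r: "pointed_rep dyck x r" for r
  proof -
    obtain g' k' where r_eq: "r = (g', k')" by (cases r)
    have rep': "pointed_rep dyck x (g', k')" using r r_eq by simp
    define b where "b g k j = start_pos g j - int k" for g :: "int \<Rightarrow> sign list" and k :: nat and j :: int
    have b_Suc: "b g k (j + 1) = b g k j + int (length (g j))" for g k j
      by (simp add: b_def start_pos_Suc)
    have props: "strict_mono (b g k)" "b g k 0 = - int k" "k < length (g 0)" "walk_mins x = range (b g k)"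
      if "pointed_rep dyck x (g, k)" for g k
    proof -
      have "g j \<noteq> []" for j using that by (auto simp: pointed_rep_def dyck_def)
      then show "strict_mono (b g k)" by (intro strict_mono_intI) (simp add: b_Suc)
      show "b g k 0 = - int k" by (simp add: b_def)
      show "k < length (g 0)" using that by (simp add: pointed_rep_def)
      show "walk_mins x = range (b g k)" using walk_mins_eq[OF that] by (simp add: b_def[abs_def])
    qed
    \<comment> \<open>The value \<open>b g' k' 0 \<le> 0\<close> occurs as some
      \<open>b g k j\<close>, and \<open>0 < b g k 1\<close> forces \<open>j \<le> 0\<close>.
      Exchanging the two representations gives equality.\<close>
    have le: "b g' k' 0 \<le> b g k 0" if rep: "pointed_rep dyck x (g, k)" "pointed_rep dyck x (g', k')" for g k g' k'
    proof -
      obtain j where j: "b g' k' 0 = b g k j" using props(4)[OF rep(1)] props(4)[OF rep(2)] by blast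
      have "b g k j < b g k (0 + 1)"
        using j props(2,3)[OF rep(1)] props(2)[OF rep(2)] unfolding b_Suc by simp
      then have "j \<le> 0" using props(1)[OF rep(1)] strict_mono_less[of "b g k" j 1] by simp
      then show ?thesis using props(1)[OF rep(1)] j strict_mono_less_eq[of "b g k" j 0] by simp
    qed
    have b0: "b g' k' 0 = b g k 0" using le[OF rep rep'] le[OF rep' rep] by simp
    then have kk: "k' = k" using props(2)[OF rep] props(2)[OF rep'] by simp
    have bb: "b g' k' j = b g k j" for j
      by (rule strict_mono_range_unique[OF props(1)[OF rep'] props(1)[OF rep] _ b0])
        (use props(4)[OF rep] props(4)[OF rep'] in simp)
    have "g' j = g j" for j
    proof -
      have "length (g' j) = length (g j)" using b_Suc[of g k j] b_Suc[of g' k' j] bb[of j] bb[of "j + 1"] by simp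
      then show ?thesis using pointed_rep_word[OF rep, of j] pointed_rep_word[OF rep', of j] bb[of j] by (simp add: b_def)
    qed
    then show ?thesis using kk r_eq by auto
  qed
  with rep show "\<exists>!r. pointed_rep dyck x r" by blast
qed

section \<open>Concatenations characterised by minima far out on both sides\<close>

lemma int_next:
  assumes "t < (u::int)" "u \<in> B"
  shows "\<exists>u\<in>B. t < u \<and> (\<forall>v\<in>B. t < v \<longrightarrow> u \<le> v)"
proof -
  let ?P = "\<lambda>n. t + 1 + int n \<in> B"
  have P: "?P (nat (u - t - 1))" using assms by simp
  show ?thesis
  proof (intro bexI conjI ballI impI)
    show "t + 1 + int (Least ?P) \<in> B" using P by (rule LeastI)
    show "t < t + 1 + int (Least ?P)" by simp
    fix v assume "v \<in> B" "t < v"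
    then have "Least ?P \<le> nat (v - t - 1)" by (intro Least_le) simp
    then show "t + 1 + int (Least ?P) \<le> v" using \<open>t < v\<close> by linarith
  qed
qed

text \<open>A set of integers unbounded on both sides is ordered like the integers. The
  normalisation places the origin between \<open>b 0\<close> (included) and \<open>b 1\<close>
  (excluded), as in a pointed representation.\<close>

lemma int_enumerate:
  fixes B :: "int set"
  assumes up: "\<And>N. \<exists>t\<in>B. N \<le> t" and down: "\<And>N. \<exists>t\<in>B. t \<le> N"
  obtains b where "\<And>j. b j \<in> B" "\<And>j. b j < b (j + 1)" "\<And>j t. b j < t \<Longrightarrow> t < b (j + 1) \<Longrightarrow> t \<notin> B"
    "b 0 \<le> 0" "0 < b (1::int)"
proof -
  have "\<exists>u\<in>B. t < u \<and> (\<forall>v\<in>B. t < v \<longrightarrow> u \<le> v)" for t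
  proof -
    obtain u where "u \<in> B" "t + 1 \<le> u" using up by blast
    then show ?thesis using int_next[of t u B] by simp
  qed
  then obtain nxt where nxt: "\<And>t. nxt t \<in> B" "\<And>t. t < nxt t" "\<And>t v. v \<in> B \<Longrightarrow> t < v \<Longrightarrow> nxt t \<le> v"
    by metis
  have "\<exists>u\<in>B. u < t \<and> (\<forall>v\<in>B. v < t \<longrightarrow> v \<le> u)" for t
  proof -
    obtain u where "u \<in> B" "u \<le> t - 1" using down by blast
    then have "\<exists>u\<in>uminus ` B. - t < u \<and> (\<forall>v\<in>uminus ` B. - t < v \<longrightarrow> u \<le> v)"
      using int_next[of "- t" "- u" "uminus ` B"] by simp
    then show ?thesis by force
  qed
  then obtain prv where prv: "\<And>t. prv t \<in> B" "\<And>t. prv t < t" "\<And>t v. v \<in> B \<Longrightarrow> v < t \<Longrightarrow> v \<le> prv t"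
    by metis
  \<comment> \<open>Negative indices are reached by \<open>prv\<close>; since \<open>nxt\<close>
    undoes it on \<open>B\<close>, the recursion \<open>b (j + 1) = nxt (b j)\<close> holds for all
    integers.\<close>
  have nxt_prv: "nxt (prv t) = t" if "t \<in> B" for t
  proof (rule antisym)
    show "nxt (prv t) \<le> t" using nxt(3)[OF that prv(2)] .
    show "t \<le> nxt (prv t)"
      using prv(3)[OF nxt(1), of "prv t" t] nxt(2)[of "prv t"] by (cases "nxt (prv t) < t") auto
  qed
  \<comment> \<open>\<open>prv 1\<close> is the largest element of \<open>B\<close> below 1, so the
    enumeration starts at the last element that is at most 0.\<close>
  define b where "b j = (if 0 \<le> j then (nxt ^^ nat j) (prv 1) else (prv ^^ nat (- j)) (prv 1))" for j :: int
  have bB: "b j \<in> B" for j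
  proof -
    have "(nxt ^^ n) (prv 1) \<in> B" "(prv ^^ n) (prv 1) \<in> B" for n
      by (induction n) (simp_all add: nxt prv)
    then show ?thesis by (simp add: b_def)
  qed
  have b_Suc: "b (j + 1) = nxt (b j)" for j
  proof (cases "0 \<le> j")
    case True
    then have "nat (j + 1) = Suc (nat j)" by simp
    with True show ?thesis by (simp add: b_def)
  next
    case False
    then have "nat (- j) = Suc (nat (- (j + 1)))" by simp
    with False have "b j = prv (b (j + 1))" by (auto simp: b_def)
    then show ?thesis using nxt_prv[OF bB] by simp
  qed
  show ?thesis
  proof (rule that[OF bB])
    show "b j < b (j + 1)" for j by (simp add: b_Suc nxt)
    show "t \<notin> B" if "b j < t" "t < b (j + 1)" for j t
      using nxt(3)[OF _ that(1)] that(2) by (auto simp: b_Suc)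
    show "b 0 \<le> 0" using prv(2)[of 1] by (simp add: b_def)
    show "0 < b 1"
    proof (rule ccontr)
      assume "\<not> 0 < b 1"
      then have "b 1 \<le> prv 1" using prv(3)[OF bB, of 1 1] by simp
      moreover have "b 0 < b 1" using b_Suc[of 0] nxt(2)[of "b 0"] by simp
      ultimately show False by (simp add: b_def)
    qed
  qed
qed

text \<open>Minima arbitrarily far out on both sides are what allows cutting into finite words;
  between consecutive minima the walk is strictly higher, so the pieces are primitive Dyck words.
  This form serves both measurability and the test for residual points.\<close>

lemma X_con_dyck_eq:
  "X_con dyck = {x. \<forall>N. (\<exists>t\<in>walk_mins x. N \<le> t) \<and> (\<exists>t\<in>walk_mins x. t \<le> N)}"
proof (intro set_eqI iffI)
  fix x assume "x \<in> X_con dyck"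
  then obtain g k where rep: "pointed_rep dyck x (g, k)" by (auto simp: X_con_def)
  define b where "b j = start_pos g j - int k" for j
  have mins: "walk_mins x = range b" using walk_mins_eq[OF rep] by (simp add: b_def[abs_def])
  have ne: "1 \<le> length (g j)" for j using rep by (auto simp: pointed_rep_def dyck_def Suc_le_eq)
  have b_Suc: "b j + 1 \<le> b (j + 1)" for j using ne[of j] by (simp add: b_def start_pos_Suc)
  have up: "b 0 + int n \<le> b (int n)" for n
  proof (induction n)
    case (Suc n)
    then show ?case using b_Suc[of "int n"] by (simp add: algebra_simps)
  qed simp
  have down: "b (- int n) \<le> b 0 - int n" for n
  proof (induction n)
    case (Suc n)
    then show ?case using b_Suc[of "- int (Suc n)"] by simp
  qed simp
  show "x \<in> {x. \<forall>N. (\<exists>t\<in>walk_mins x. N \<le> t) \<and> (\<exists>t\<in>walk_mins x. t \<le> N)}"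
  proof (intro CollectI allI conjI)
    fix N
    have "N \<le> b (int (nat (N - b 0)))" using up[of "nat (N - b 0)"] by linarith
    then show "\<exists>t\<in>walk_mins x. N \<le> t" unfolding mins by blast
    have "b (- int (nat (b 0 - N))) \<le> N" using down[of "nat (b 0 - N)"] by linarith
    then show "\<exists>t\<in>walk_mins x. t \<le> N" unfolding mins by blast
  qed
next
  fix x assume "x \<in> {x. \<forall>N. (\<exists>t\<in>walk_mins x. N \<le> t) \<and> (\<exists>t\<in>walk_mins x. t \<le> N)}"
  then obtain b where b: "\<And>j. b j \<in> walk_mins x" "\<And>j. b j < b (j + 1)"
      "\<And>j t. b j < t \<Longrightarrow> t < b (j + 1) \<Longrightarrow> t \<notin> walk_mins x" "b 0 \<le> 0" "0 < b (1::int)"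
    using int_enumerate[of "walk_mins x"] by blast
  define g where "g j = word_at x (b j) (nat (b (j + 1) - b j))" for j
  have len: "int (length (g j)) = b (j + 1) - b j" for j
    using b(2)[of j] by (simp add: g_def)
  have sp: "start_pos g j = b j - b 0" for j
  proof (rule int_all_induct[where P = "\<lambda>j. start_pos g j = b j - b 0"])
    show "start_pos g j = b j - b 0 \<longleftrightarrow> start_pos g (j + 1) = b (j + 1) - b 0" for j
      unfolding start_pos_Suc len by linarith
  qed simp
  have le: "walk x (b j) \<le> walk x u" for j u using b(1)[of j] by (auto simp: walk_mins_def)
  have dyck: "g j \<in> dyck" for j
    unfolding dyck_def
  proof (intro CollectI conjI allI impI)
    show "g j \<noteq> []" using len[of j] b(2)[of j] by auto
    have "walk x (b (j + 1)) = walk x (b j)" by (intro antisym le)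
    moreover have "word_at x (b j) (length (g j)) = g j" by (simp add: g_def)
    ultimately show "wsum (g j) = 0"
      using walk_add[of x "b j" "length (g j)"] by (simp add: len)
    \<comment> \<open>A time strictly between consecutive minima is no minimum, so its height
      exceeds some other height, and with it the minimal height \<open>walk x (b j)\<close>.\<close>
    fix k assume k: "0 < k \<and> k < length (g j)"
    then have "b j + int k \<notin> walk_mins x" using len[of j] by (intro b(3)[of j]) auto
    then obtain u where "walk x u < walk x (b j + int k)" by (auto simp: walk_mins_def not_le)
    with le[of j u] have "walk x (b j) < walk x (b j + int k)" by linarith
    moreover have "take k (g j) = word_at x (b j) k" using k unfolding g_def by (intro take_word_at) simp
    ultimately show "0 < wsum (take k (g j))" by (simp add: walk_add)
  qed
  define k where "k = nat (- b 0)"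
  have k: "int k = - b 0" using b(4) by (simp add: k_def)
  have ne: "g j \<noteq> []" for j using dyck[of j] by (simp add: dyck_def)
  have "x n = biconcat g (n + int k)" for n
  proof -
    obtain j i where ji: "i < length (g j)" "n + int k = start_pos g j + int i"
      using start_pos_cover[of g "n + int k"] ne by blast
    then have n: "n = b j + int i" by (simp add: sp k)
    have "biconcat g (n + int k) = g j ! i" using biconcat_nth[of i g j, OF ji(1)] ji(2) by simp
    also have "\<dots> = x n" using ji(1) by (simp add: g_def n)
    finally show ?thesis by simp
  qed
  moreover have "k < length (g 0)" using len[of 0] k b(5) by simp
  ultimately have "pointed_rep dyck x (g, k)"
    using dyck by (auto simp: pointed_rep_def funpow_shift)
  then show "x \<in> X_con dyck" by (auto simp: X_con_def)
qed

section \<open>Density and measurability of the concatenation set\<close>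

lemma open_contains_cylinder:
  fixes x :: "int \<Rightarrow> 'a::topological_space"
  assumes "open U" "x \<in> U"
  obtains m where "\<And>y. (\<And>i. \<bar>i\<bar> \<le> int m \<Longrightarrow> y i = x i) \<Longrightarrow> y \<in> U"
proof -
  have "openin (product_topology (\<lambda>_::int. euclidean :: 'a topology) UNIV) U"
    using assms(1) by (simp add: euclidean_product_topology)
  then obtain V where V: "x \<in> Pi\<^sub>E UNIV V" "finite {i. V i \<noteq> UNIV}" "Pi\<^sub>E UNIV V \<subseteq> U"
    using product_topology_open_contains_basis[of "\<lambda>_. euclidean" UNIV U x] assms(2) by force
  obtain m where m: "\<And>i. V i \<noteq> UNIV \<Longrightarrow> nat \<bar>i\<bar> \<le> m"
    using finite_nat_set_iff_bounded_le[of "(\<lambda>i. nat \<bar>i\<bar>) ` {i. V i \<noteq> UNIV}"] V(2) by auto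
  show ?thesis
  proof (rule that[of m])
    fix y assume y: "\<And>i. \<bar>i\<bar> \<le> int m \<Longrightarrow> y i = x i"
    have "y i \<in> V i" for i
      using y[of i] m[of i] V(1) by (cases "V i = UNIV") (auto simp: PiE_iff)
    then show "y \<in> U" using V(3) by (auto simp: PiE_iff)
  qed
qed

text \<open>After padding, any finite window sits inside a primitive Dyck word, and the periodic
  repetition of that word is a concatenation that agrees with \<open>x\<close> on the
  window.\<close>

lemma coded_shift_dyck: "coded_shift dyck = UNIV"
  unfolding coded_shift_def
proof (intro set_eqI iffI UNIV_I)
  fix x :: "int \<Rightarrow> sign"
  show "x \<in> closure (X_con dyck)"
    unfolding closure_iff_nhds_not_empty
  proof (intro allI impI)
    fix A U assume U: "U \<subseteq> A" "open U" "x \<in> U"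
    obtain m where m: "\<And>y. (\<And>i. \<bar>i\<bar> \<le> int m \<Longrightarrow> y i = x i) \<Longrightarrow> y \<in> U"
      using open_contains_cylinder[OF U(2,3)] by blast
    define u where "u = word_at x (- int m) (2 * m + 1)"
    \<comment> \<open>The window has \<open>2 * m + 1\<close> letters, so an ascent of
      \<open>2 * m + 2\<close> keeps the walk above 0; the descent also undoes the sum of
      \<open>u\<close>.\<close>
    define w where "w = replicate (2 * m + 2) Plus @ u @ replicate (nat (2 * int m + 2 + wsum u)) Minus"
    have w: "w \<in> dyck"
      unfolding w_def
    proof (rule padded_dyck)
      show "- int (2 * m + 2) < wsum (take k u)" for k
        using wsum_bounds[of "take k u"] by (simp add: u_def)
      show "int (nat (2 * int m + 2 + wsum u)) = int (2 * m + 2) + wsum u"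
        using wsum_bounds[of u] by (simp add: u_def)
    qed
    define g where "g = (\<lambda>_::int. w)"
    \<comment> \<open>Position \<open>(2 * m + 2) + m\<close> of \<open>w\<close> is the centre of
      \<open>u\<close>, which the shift brings to coordinate 0.\<close>
    define k where "k = 3 * m + 2"
    define y where "y = (shift ^^ k) (biconcat g)"
    have "k < length (g 0)" by (simp add: g_def w_def k_def u_def)
    then have rep: "pointed_rep dyck y (g, k)" using w by (simp add: pointed_rep_def g_def y_def)
    have "y i = x i" if "\<bar>i\<bar> \<le> int m" for i
    proof -
      define l where "l = nat (i + int m)"
      have l: "l < 2 * m + 1" "int l = i + int m" using that by (auto simp: l_def)
      have "2 * m + 2 + l < length (g 0)" using l by (simp add: g_def w_def u_def)
      from biconcat_nth[of _ g 0, OF this] have "biconcat g (int (2 * m + 2 + l)) = w ! (2 * m + 2 + l)"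
        by (simp add: g_def)
      also have "\<dots> = x i" using l by (simp add: w_def nth_append u_def)
      also have "int (2 * m + 2 + l) = i + int k" using l by (simp add: k_def)
      finally show ?thesis by (simp add: y_def funpow_shift)
    qed
    then have "y \<in> A" using m U(1) by blast
    moreover have "y \<in> X_con dyck" using rep by (auto simp: X_con_def)
    ultimately show "X_con dyck \<inter> A \<noteq> {}" by blast
  qed
qed

lemma coordinate_measurable:
  "(\<lambda>x :: int \<Rightarrow> 'a::discrete_topology. f (x i)) \<in> borel_measurable borel"
proof (rule borel_measurableI)
  fix S :: "'b set"
  have "open ((\<lambda>x :: int \<Rightarrow> 'a. x i) -` (f -` S))"
    by (intro open_vimage open_discrete continuous_on_product_coordinates)
  then show "(\<lambda>x. f (x i)) -` S \<inter> space borel \<in> sets borel"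
    by (simp add: vimage_def)
qed

text \<open>The characterisation by minima quantifies over integers and compares finite sums of
  coordinates, so it consists of countably many measurable conditions.\<close>

lemma X_con_dyck_measurable: "X_con dyck \<in> sets borel"
proof -
  have [measurable]: "(\<lambda>x. real_of_int (walk x t)) \<in> borel_measurable borel" for t
    unfolding walk_def of_int_diff of_int_sum
    by (intro borel_measurable_diff borel_measurable_sum coordinate_measurable)
  have eq: "{x. t \<in> walk_mins x} = (\<Inter>u. {x \<in> space borel. real_of_int (walk x t) \<le> real_of_int (walk x u)})" for t
    by (auto simp: walk_mins_def)
  have "{x. t \<in> walk_mins x} \<in> sets borel" for t
    unfolding eq by (intro sets.countable_INT'' UNIV_I) measurable
  then have "(\<Inter>N. (\<Union>t\<in>{N..}. {x. t \<in> walk_mins x}) \<inter> (\<Union>t\<in>{..N}. {x. t \<in> walk_mins x})) \<in> sets borel"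
    by (intro sets.countable_INT'' sets.Int sets.countable_UN' UNIV_I) auto
  also have "(\<Inter>N. (\<Union>t\<in>{N..}. {x. t \<in> walk_mins x}) \<inter> (\<Union>t\<in>{..N}. {x. t \<in> walk_mins x})) = X_con dyck"
    unfolding X_con_dyck_eq by auto
  finally show ?thesis .
qed

section \<open>The coordinate partition generates\<close>

text \<open>The set depends only on the coordinates from \<open>- m\<close> to \<open>m\<close>; one
  implication suffices because agreement on the window is symmetric.\<close>

definition cylinder :: "nat \<Rightarrow> (int \<Rightarrow> 'a) set \<Rightarrow> bool" where
  "cylinder m C \<longleftrightarrow> (\<forall>x y. (\<forall>i. \<bar>i\<bar> \<le> int m \<longrightarrow> x i = y i) \<longrightarrow> x \<in> C \<longrightarrow> y \<in> C)"

lemma cylinderD: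
  "cylinder m C \<Longrightarrow> (\<And>i. \<bar>i\<bar> \<le> int m \<Longrightarrow> x i = y i) \<Longrightarrow> x \<in> C \<longleftrightarrow> y \<in> C"
  unfolding cylinder_def by metis

lemma cylinder_mono: "cylinder m C \<Longrightarrow> m \<le> n \<Longrightarrow> cylinder n C"
  unfolding cylinder_def by (meson of_nat_le_iff order_trans)

lemma cylinder_borel:
  fixes C :: "(int \<Rightarrow> 'a::discrete_topology) set"
  assumes "cylinder m C" shows "C \<in> sets borel"
proof -
  have "open (\<Union>x\<in>C. \<Inter>i\<in>{- int m..int m}. (\<lambda>y. y i) -` {x i})"
    by (intro open_UN ballI open_INT open_vimage open_discrete continuous_on_product_coordinates) auto
  also have "(\<Union>x\<in>C. \<Inter>i\<in>{- int m..int m}. (\<lambda>y. y i) -` {x i}) = C"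
  proof (intro set_eqI iffI)
    fix y assume "y \<in> (\<Union>x\<in>C. \<Inter>i\<in>{- int m..int m}. (\<lambda>y. y i) -` {x i})"
    then obtain x where "x \<in> C" "\<And>i. \<bar>i\<bar> \<le> int m \<Longrightarrow> x i = y i"
      by (auto simp: abs_le_iff)
    then show "y \<in> C" using cylinderD[OF assms, of x y] by simp
  qed auto
  finally show ?thesis by simp
qed

lemma cylinder_Un:
  assumes "cylinder m C" "cylinder n D" shows "cylinder (max m n) (C \<union> D)"
proof -
  have C: "cylinder (max m n) C" and D: "cylinder (max m n) D"
    using assms by (auto intro: cylinder_mono)
  show ?thesis
    unfolding cylinder_def
  proof (intro allI impI)
    fix x y :: "int \<Rightarrow> 'a"
    assume "\<forall>i. \<bar>i\<bar> \<le> int (max m n) \<longrightarrow> x i = y i" "x \<in> C \<union> D"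
    then show "y \<in> C \<union> D" using cylinderD[OF C, of x y] cylinderD[OF D, of x y] by auto
  qed
qed

lemma cylinder_UN_lessThan:
  assumes "\<And>n. \<exists>m. cylinder m (C n)" shows "\<exists>m. cylinder m (\<Union>n<(N::nat). C n)"
proof (induction N)
  case 0 then show ?case by (simp add: cylinder_def)
next
  case (Suc N)
  then show ?case using assms[of N] cylinder_Un by (metis UN_insert lessThan_Suc)
qed

definition approximable :: "(int \<Rightarrow> 'a) measure \<Rightarrow> (int \<Rightarrow> 'a) set \<Rightarrow> bool" where
  "approximable M A \<longleftrightarrow> (\<forall>e>0. \<exists>m C. cylinder m C \<and> measure M ((A - C) \<union> (C - A)) < e)"

text \<open>Half of \<open>e\<close> pays for truncating the union after \<open>N\<close> sets, the
  other half for approximating these sets one by one.\<close>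

lemma approximable_UN:
  fixes A :: "nat \<Rightarrow> (int \<Rightarrow> 'b::discrete_topology) set" and M :: "(int \<Rightarrow> 'b) measure"
  assumes M: "prob_space M" "sets M = sets borel"
    and A: "\<And>n. A n \<in> sets borel" "\<And>n. approximable M (A n)"
  shows "approximable M (\<Union>n. A n)"
  unfolding approximable_def
proof (intro allI impI)
  interpret prob_space M by fact
  fix e :: real assume e: "0 < e"
  define B where "B N = (\<Union>n<N. A n)" for N
  have B: "B N \<in> sets M" for N using A M(2) by (auto simp: B_def)
  have "(\<lambda>N. measure M (B N)) \<longlonglongrightarrow> measure M (\<Union>N. B N)"
  proof (rule finite_Lim_measure_incseq)
    show "incseq B" unfolding B_def by (intro monoI UN_mono) auto
  qed (use B in auto)
  also have "(\<Union>N. B N) = (\<Union>n. A n)" by (auto simp: B_def)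
  finally obtain N where "norm (measure M (B N) - measure M (\<Union>n. A n)) < e / 2"
    using LIMSEQ_D[of _ _ "e / 2"] e by (metis half_gt_zero order_refl)
  then have N: "measure M (\<Union>n. A n) - measure M (B N) < e / 2" unfolding real_norm_def by linarith
  \<comment> \<open>\<open>Suc N\<close> in place of \<open>N\<close> keeps the tolerance positive
    when \<open>N = 0\<close>.\<close>
  have "\<exists>C. (\<exists>m. cylinder m C) \<and> measure M ((A n - C) \<union> (C - A n)) < e / (2 * real (Suc N))" for n
  proof -
    have "0 < e / (2 * real (Suc N))" using e by simp
    then show ?thesis using A(2)[of n] unfolding approximable_def by blast
  qed
  then obtain C where C: "\<And>n. \<exists>m. cylinder m (C n)"
      "\<And>n. measure M ((A n - C n) \<union> (C n - A n)) < e / (2 * real (Suc N))" by metis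
  have CM: "C n \<in> sets M" for n using C(1)[of n] cylinder_borel M(2) by auto
  have AM: "A n \<in> sets M" for n using A M(2) by auto
  let ?D = "\<lambda>n. (A n - C n) \<union> (C n - A n)"
  obtain m where m: "cylinder m (\<Union>n<N. C n)" using cylinder_UN_lessThan[of C N, OF C(1)] by blast
  have UA: "(\<Union>n. A n) \<in> sets M" using AM by auto
  have "measure M (((\<Union>n. A n) - (\<Union>n<N. C n)) \<union> ((\<Union>n<N. C n) - (\<Union>n. A n)))
      \<le> measure M (((\<Union>n. A n) - B N) \<union> (\<Union>n<N. ?D n))"
    using AM CM B UA by (intro finite_measure_mono) (auto simp: B_def)
  also have "\<dots> \<le> measure M ((\<Union>n. A n) - B N) + measure M (\<Union>n<N. ?D n)"
    using AM CM B UA by (intro measure_Un_le) auto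
  also have "measure M ((\<Union>n. A n) - B N) = measure M (\<Union>n. A n) - measure M (B N)"
    using B UA by (intro finite_measure_Diff) (auto simp: B_def)
  also have "measure M (\<Union>n<N. ?D n) \<le> (\<Sum>n<N. measure M (?D n))"
    using AM CM by (intro finite_measure_subadditive_finite) auto
  also have "\<dots> \<le> (\<Sum>n<N. e / (2 * real (Suc N)))"
    using C(2) by (intro sum_mono) (simp add: less_imp_le)
  also have "\<dots> \<le> e / 2" using e by (simp add: field_simps)
  finally have "measure M (((\<Union>n. A n) - (\<Union>n<N. C n)) \<union> ((\<Union>n<N. C n) - (\<Union>n. A n))) < e"
    using N by linarith
  with m show "\<exists>m C. cylinder m C \<and> measure M (((\<Union>n. A n) - C) \<union> (C - (\<Union>n. A n))) < e" by blast
qed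

text \<open>The approximable Borel sets form a sigma-algebra: complementing both sets preserves the
  symmetric difference, and unions are \<open>approximable_UN\<close>. Open sets belong to it as
  countable unions of cylinders. Membership in \<open>sets borel\<close> is carried through the
  induction for the union step.\<close>

lemma borel_approximable:
  fixes A :: "(int \<Rightarrow> 'b::discrete_topology) set"
  assumes M: "prob_space M" "sets M = sets borel" and A: "A \<in> sets borel"
  shows "approximable M A"
proof -
  interpret prob_space M by fact
  have cyl: "approximable M C" if "cylinder m C" for m C
    unfolding approximable_def using that by (metis Diff_cancel Un_absorb measure_empty)
  have "A \<in> sigma_sets UNIV {S. open S}" using A by (simp add: borel_def)
  then have "A \<in> sets borel \<and> approximable M A"
  proof (induction rule: sigma_sets.induct)
    case (Basic U)
    define C where "C m = {x. \<forall>y. (\<forall>i. \<bar>i\<bar> \<le> int m \<longrightarrow> y i = x i) \<longrightarrow> y \<in> U}" for m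
    have C: "cylinder m (C m)" for m unfolding cylinder_def C_def by auto
    have "U = (\<Union>m. C m)"
    proof (intro set_eqI iffI)
      fix x assume "x \<in> U"
      then obtain m where "\<And>y. (\<And>i. \<bar>i\<bar> \<le> int m \<Longrightarrow> y i = x i) \<Longrightarrow> y \<in> U"
        using open_contains_cylinder[of U x] Basic by auto
      then show "x \<in> (\<Union>m. C m)" by (auto simp: C_def)
    qed (auto simp: C_def)
    moreover have "approximable M (\<Union>m. C m)"
      using C cyl cylinder_borel by (intro approximable_UN[OF M]) blast+
    ultimately show ?case using Basic by simp
  next
    case Empty
    have "cylinder 0 {}" by (simp add: cylinder_def)
    with cyl show ?case by simp
  next
    case (Compl A)
    have "\<exists>m C. cylinder m C \<and> measure M (((UNIV - A) - C) \<union> (C - (UNIV - A))) < e" if "0 < e" for e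
    proof -
      obtain m C where mC: "cylinder m C" "measure M ((A - C) \<union> (C - A)) < e"
        using Compl.IH \<open>0 < e\<close> unfolding approximable_def by blast
      have "((UNIV - A) - (- C)) \<union> ((- C) - (UNIV - A)) = (A - C) \<union> (C - A)" by auto
      moreover have "cylinder m (- C)" using mC(1) unfolding cylinder_def by (metis ComplD ComplI)
      ultimately show ?thesis using mC(2) by (metis (no_types, lifting))
    qed
    then show ?case using Compl.IH unfolding approximable_def by auto
  next
    case (Union A)
    then show ?case using approximable_UN[OF M, of A] by auto
  qed
  then show ?thesis by simp
qed

section \<open>Entropy of rare errors and the generator theorem\<close>

text \<open>From \<open>ln t \<le> t - 1\<close> at \<open>t = 1 / sqrt p\<close>. It serves as an
  explicit modulus of continuity of \<open>- (p * ln p)\<close> at 0.\<close>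

lemma neg_x_ln_x_le_sqrt:
  assumes "0 \<le> (p::real)" shows "- (p * ln p) \<le> 2 * sqrt p"
proof (cases "p = 0")
  case False
  then have p: "0 < p" using assms by simp
  have "ln (1 / sqrt p) \<le> 1 / sqrt p - 1" using p by (intro ln_le_minus_one) simp
  then have "- ln p \<le> 2 / sqrt p" using p by (simp add: ln_div ln_sqrt)
  then have "p * (- ln p) \<le> p * (2 / sqrt p)" using p by (intro mult_left_mono) auto
  also have "\<dots> = 2 * (p / sqrt p)" by simp
  also have "p / sqrt p = sqrt p" by (rule real_div_sqrt[OF assms])
  finally show ?thesis by simp
qed simp

text \<open>The value \<open>None\<close> contributes at most the probability of its complement, and
  every other value at most twice the square root of that probability; hence the square in the
  hypothesis.\<close>

lemma (in prob_space) ent_error_le: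
  assumes E: "simple_function M E" "E ` space M \<subseteq> insert None (Some ` P)" and P: "finite P"
    and d: "prob {x \<in> space M. E x \<noteq> None} \<le> d\<^sup>2" "0 \<le> d" "d \<le> 1"
  shows "ent M E \<le> d * (1 + 2 * real (card P))"
proof -
  define p where "p v = prob (E -` {v} \<inter> space M)" for v
  have ev: "E -` {v} \<inter> space M \<in> events" for v using E(1) by (rule simple_functionD)
  have ev': "{x \<in> space M. E x \<noteq> None} \<in> events"
  proof -
    have "{x \<in> space M. E x \<noteq> None} = space M - (E -` {None} \<inter> space M)" by auto
    then show ?thesis using ev by auto
  qed
  have None: "- (p None * ln (p None)) \<le> d\<^sup>2"
  proof (cases "p None = 0")
    case False
    then have p: "0 < p None" by (simp add: p_def zero_less_measure_iff)
    have "p None = 1 - prob {x \<in> space M. E x \<noteq> None}"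
    proof -
      have "E -` {None} \<inter> space M = space M - {x \<in> space M. E x \<noteq> None}" by auto
      then show ?thesis using prob_compl[OF ev'] by (simp add: p_def)
    qed
    moreover have "p None * ln (1 / p None) \<le> p None * (1 / p None - 1)"
      using p by (intro mult_left_mono ln_le_minus_one) auto
    moreover have "p None * (1 / p None - 1) = 1 - p None" "p None * ln (1 / p None) = - (p None * ln (p None))"
      using p by (simp_all add: ln_div field_simps)
    ultimately show ?thesis using d(1) by linarith
  qed simp
  have Some: "- (p (Some v) * ln (p (Some v))) \<le> 2 * d" for v
  proof -
    have "p (Some v) \<le> prob {x \<in> space M. E x \<noteq> None}"
      unfolding p_def using ev' by (intro finite_measure_mono) auto
    then have "p (Some v) \<le> d\<^sup>2" using d by linarith
    then have "sqrt (p (Some v)) \<le> d" using d(2) by (intro real_le_lsqrt) auto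
    moreover have "- (p (Some v) * ln (p (Some v))) \<le> 2 * sqrt (p (Some v))"
      by (rule neg_x_ln_x_le_sqrt) (simp add: p_def)
    ultimately show ?thesis by linarith
  qed
  have "ent M E = (\<Sum>v\<in>insert None (Some ` P). - (p v * ln (p v)))"
    using ent_eq_sum[OF _ E(2)] P by (simp add: p_def sum_negf)
  also have "\<dots> = - (p None * ln (p None)) + (\<Sum>v\<in>P. - (p (Some v) * ln (p (Some v))))"
    using P by (simp add: sum.reindex image_iff)
  also have "\<dots> \<le> d\<^sup>2 + (\<Sum>v\<in>P. 2 * d)"
    using None Some by (intro add_mono sum_mono) auto
  also have "d\<^sup>2 \<le> d" using d by (simp add: power2_eq_square mult_left_le)
  finally show ?thesis by (simp add: algebra_simps)
qed

lemma word_at_shift: "word_at ((shift ^^ m) x) a n = word_at x (a + int m) n"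
  by (simp add: word_at_def funpow_shift algebra_simps)

lemma itinerary_shift: "itinerary shift (\<lambda>x. x 0) n x = word_at x 0 n"
  by (simp add: itinerary_def word_at_def funpow_shift)

locale shift_invariant = measure_preserving M shift
  for M :: "(int \<Rightarrow> 'a::{finite,discrete_topology}) measure" +
  assumes sets_M: "sets M = sets borel"
begin

lemma space_M [simp]: "space M = UNIV"
  using sets_eq_imp_space_eq[OF sets_M] by simp

lemma simple_word_at: "simple_function M (\<lambda>x. word_at x a n)"
  unfolding simple_function_def
proof (intro conjI ballI)
  have "(\<lambda>x. word_at x a n) ` space M \<subseteq> {w. set w \<subseteq> UNIV \<and> length w = n}" by auto
  then show "finite ((\<lambda>x. word_at x a n) ` space M)"
    using finite_lists_length_eq[OF finite, where n = n] by (rule finite_subset)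
  fix w :: "'a list"
  have "cylinder (nat \<bar>a\<bar> + n) ((\<lambda>x. word_at x a n) -` {w})"
  proof -
    have "word_at x a n = word_at y a n" if "\<And>i. \<bar>i\<bar> \<le> int (nat \<bar>a\<bar> + n) \<Longrightarrow> x i = y i" for x y
      unfolding word_at_def by (intro map_cong that) auto
    note cong = this
    show ?thesis
      unfolding cylinder_def
    proof (intro allI impI)
      fix x y
      assume "\<forall>i. \<bar>i\<bar> \<le> int (nat \<bar>a\<bar> + n) \<longrightarrow> x i = y i" "x \<in> (\<lambda>x. word_at x a n) -` {w}"
      with cong[of x y] show "y \<in> (\<lambda>x. word_at x a n) -` {w}" by simp
    qed
  qed
  then show "(\<lambda>x. word_at x a n) -` {w} \<inter> space M \<in> sets M"
    using cylinder_borel sets_M by auto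
qed

lemma simple_coordinate: "simple_function M (\<lambda>x. x 0)"
  using simple_function_compose[OF simple_word_at[of 0 1], of hd] by (simp add: comp_def word_at_def)

lemma ent_word_at: "ent M (\<lambda>x. word_at x (- int m) n) = ent M (\<lambda>x. word_at x 0 n)"
proof -
  have "ent M (\<lambda>x. word_at x (- int m) n) = ent (distr M M (shift ^^ m)) (\<lambda>x. word_at x (- int m) n)"
    by (simp add: distr_funpow)
  also have "\<dots> = ent M (\<lambda>x. word_at x 0 n)"
    by (subst ent_distr[OF funpow_measurable simple_word_at]) (simp add: comp_def word_at_shift)
  finally show ?thesis .
qed

abbreviation shift_entropy :: real where
  "shift_entropy \<equiv> ks_entropy_partition M shift (fibers M (\<lambda>x. x 0))"

lemma shift_entropy_lim: "(\<lambda>n. ent M (\<lambda>x. word_at x 0 n) / real n) \<longlonglongrightarrow> shift_entropy"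
  and shift_entropy_le: "0 < n \<Longrightarrow> shift_entropy \<le> ent M (\<lambda>x. word_at x 0 n) / real n"
  using ks_entropy_partition_fibers(1)[OF simple_coordinate] ks_entropy_partition_fibers(2)[OF simple_coordinate, of n]
  by (simp_all add: itinerary_shift[abs_def])

text \<open>\<open>f\<close> is recovered from its approximation \<open>f'\<close> and an error variable that is almost always
  \<open>None\<close>; subadditivity then replaces the usual estimates with conditional entropies.\<close>

lemma ks_entropy_partition_le_error:
  assumes f: "simple_function M f" and f': "\<And>x. f' x = F (word_at x (- int m) (2 * m + 1))"
    and err: "ent M (\<lambda>x. if f x = f' x then None else Some (f x)) \<le> e"
  shows "ks_entropy_partition M shift (fibers M f) \<le> shift_entropy + e"
proof -
  let ?E = "\<lambda>x. if f x = f' x then None else Some (f x)"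
  have f'_simple: "simple_function M f'"
    using simple_function_compose[OF simple_word_at, of F "- int m" "2 * m + 1"]
    by (simp add: comp_def f'[abs_def])
  have E: "simple_function M ?E"
    using simple_function_compose[OF simple_function_Pair[OF f f'_simple],
        of "\<lambda>(u, v). if u = v then None else Some u"] by (simp add: comp_def)
  have le: "ent M (itinerary shift f n) \<le> ent M (\<lambda>x. word_at x 0 (n + 2 * m)) + real n * e" for n
  proof -
    have "ent M (itinerary shift f n) \<le> ent M (\<lambda>x. (itinerary shift f' n x, itinerary shift ?E n x))"
    proof (rule ent_le[OF simple_function_Pair[OF simple_itinerary[OF f'_simple] simple_itinerary[OF E]],
          where f = "\<lambda>(u, v). map2 (\<lambda>a b. case b of None \<Rightarrow> a | Some c \<Rightarrow> c) u v"])
      show "itinerary shift f n x = (case (itinerary shift f' n x, itinerary shift ?E n x) of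
          (u, v) \<Rightarrow> map2 (\<lambda>a b. case b of None \<Rightarrow> a | Some c \<Rightarrow> c) u v)" for x
        by (auto simp: itinerary_def intro!: nth_equalityI)
    qed
    also have "\<dots> \<le> ent M (itinerary shift f' n) + ent M (itinerary shift ?E n)"
      by (rule ent_Pair_le[OF simple_itinerary[OF f'_simple] simple_itinerary[OF E]])
    also have "ent M (itinerary shift ?E n) \<le> real n * e"
      using ent_itinerary_le[OF E, of n] err by (meson mult_left_mono of_nat_0_le_iff order_trans)
    \<comment> \<open>Reading \<open>n\<close> successive windows of width \<open>2 * m + 1\<close>
      takes only \<open>n + 2 * m\<close> coordinates, an excess that does not grow with
      \<open>n\<close>.\<close>
    also have "ent M (itinerary shift f' n) \<le> ent M (\<lambda>x. word_at x (- int m) (n + 2 * m))"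
    proof (rule ent_le[OF simple_word_at, where f = "\<lambda>w. map (\<lambda>i. F (take (2 * m + 1) (drop i w))) [0..<n]"])
      fix x
      have "f' ((shift ^^ i) x) = F (take (2 * m + 1) (drop i (word_at x (- int m) (n + 2 * m))))" if "i < n" for i
      proof -
        have "take (2 * m + 1) (drop i (word_at x (- int m) (n + 2 * m))) = word_at ((shift ^^ i) x) (- int m) (2 * m + 1)"
          using that by (intro nth_equalityI) (auto simp: funpow_shift algebra_simps)
        then show ?thesis by (simp add: f')
      qed
      then show "itinerary shift f' n x = map (\<lambda>i. F (take (2 * m + 1) (drop i (word_at x (- int m) (n + 2 * m))))) [0..<n]"
        by (simp add: itinerary_def)
    qed
    also have "\<dots> = ent M (\<lambda>x. word_at x 0 (n + 2 * m))" by (rule ent_word_at)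
    finally show ?thesis by simp
  qed
  let ?b = "\<lambda>n. ent M (\<lambda>x. word_at x 0 n) / real n"
  have "(\<lambda>n. ?b (n + 2 * m) * ((real n + 2 * real m) / real n) + e) \<longlonglongrightarrow> shift_entropy * 1 + e"
  proof (intro tendsto_intros)
    show "(\<lambda>n. ?b (n + 2 * m)) \<longlonglongrightarrow> shift_entropy"
      by (rule LIMSEQ_ignore_initial_segment[OF shift_entropy_lim])
    have "(\<lambda>n. 1 + 2 * real m * (1 / real n)) \<longlonglongrightarrow> 1 + 2 * real m * 0"
      by (intro tendsto_intros lim_1_over_n)
    moreover have "eventually (\<lambda>n. 1 + 2 * real m * (1 / real n) = (real n + 2 * real m) / real n) sequentially"
      using eventually_gt_at_top[of 0] by eventually_elim (simp add: field_simps)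
    ultimately show "(\<lambda>n. (real n + 2 * real m) / real n) \<longlonglongrightarrow> 1"
      using Lim_transform_eventually by fastforce
  qed
  moreover have "eventually (\<lambda>n. ent M (itinerary shift f n) / real n
      \<le> ?b (n + 2 * m) * ((real n + 2 * real m) / real n) + e) sequentially"
    using eventually_gt_at_top[of 0]
  proof eventually_elim
    case (elim n)
    have "ent M (itinerary shift f n) / real n \<le> (ent M (\<lambda>x. word_at x 0 (n + 2 * m)) + real n * e) / real n"
      using le[of n] elim by (intro divide_right_mono) auto
    also have "\<dots> = ent M (\<lambda>x. word_at x 0 (n + 2 * m)) / real n + e"
      using elim by (simp add: add_divide_distrib)
    also have "ent M (\<lambda>x. word_at x 0 (n + 2 * m)) / real n = ?b (n + 2 * m) * (real (n + 2 * m) / real n)"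
      using elim by (simp del: of_nat_add)
    finally show ?case by simp
  qed
  ultimately have "ks_entropy_partition M shift (fibers M f) \<le> shift_entropy * 1 + e"
    using ks_entropy_partition_fibers(1)[OF f] by (intro tendsto_le[OF trivial_limit_sequentially])
  then show ?thesis by simp
qed

text \<open>Each cell is replaced by a cylinder. The resulting \<open>f'\<close> reads a finite
  window and errs only on the union of the symmetric differences, an event small enough for the
  error to have entropy at most \<open>e\<close>.\<close>

lemma ks_entropy_partition_le:
  assumes P: "finite_partition M P"
  shows "ks_entropy_partition M shift P \<le> shift_entropy"
proof (rule field_le_epsilon)
  fix e :: real assume e: "0 < e"
  have fin: "finite P" and PM: "P \<subseteq> sets M" and part: "partition_on UNIV P"
    using P by (auto simp: finite_partition_def)
  define f where "f x = (THE A. A \<in> P \<and> x \<in> A)" for x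
  have fib: "fibers M f = P" using fibers_partition[of M P] part by (simp add: f_def[abs_def])
  have fP: "f x \<in> P \<and> x \<in> f x" for x
  proof -
    have "\<exists>!A. A \<in> P \<and> x \<in> A" using part by (auto simp: partition_on_def disjoint_def)
    then show ?thesis unfolding f_def by (rule theI')
  qed
  have f_eq: "f x = A" if "A \<in> P" "x \<in> A" for A x
    using fP[of x] that part by (auto simp: partition_on_def disjoint_def)
  have f: "simple_function M f"
    unfolding simple_function_def
  proof (intro conjI ballI)
    show "finite (f ` space M)" using fP fin by (meson finite_subset image_subsetI)
    fix v assume "v \<in> f ` space M"
    then have "f -` {v} \<inter> space M \<in> fibers M f" by (auto simp: fibers_def)
    then show "f -` {v} \<inter> space M \<in> sets M" using fib PM by auto
  qed
  \<comment> \<open>\<open>d\<close> brings the bound of \<open>ent_error_le\<close> below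
    \<open>e\<close>. The tolerance per cell is \<open>d\<^sup>2\<close> divided by more than the
    number of cells, so the total error probability stays below \<open>d\<^sup>2\<close>.\<close>
  define d where "d = min 1 (e / (1 + 2 * real (card P)))"
  have "0 < 1 + 2 * real (card P)" "d \<le> e / (1 + 2 * real (card P))" by (simp_all add: d_def add_pos_nonneg)
  then have d: "0 < d" "d \<le> 1" "d * (1 + 2 * real (card P)) \<le> e"
    using e by (simp_all add: pos_le_divide_eq) (simp_all add: d_def)
  have "\<exists>m C. cylinder m C \<and> prob ((A - C) \<union> (C - A)) < d\<^sup>2 / (1 + real (card P))" if "A \<in> P" for A
  proof -
    have "0 < d\<^sup>2 / (1 + real (card P))" using d(1) by (simp add: add_pos_nonneg)
    moreover have "approximable M A" using PM sets_M that by (intro borel_approximable[OF prob_space_axioms]) auto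
    ultimately show ?thesis unfolding approximable_def by blast
  qed
  then obtain m' C where C: "\<And>A. A \<in> P \<Longrightarrow> cylinder (m' A) (C A)"
      "\<And>A. A \<in> P \<Longrightarrow> prob ((A - C A) \<union> (C A - A)) < d\<^sup>2 / (1 + real (card P))" by metis
  define m where "m = Max (insert 0 (m' ` P))"
  have m: "cylinder m (C A)" if "A \<in> P" for A
    using C(1)[OF that] cylinder_mono fin that by (metis Max_ge finite_imageI finite_insert imageI insertI2 m_def)
  \<comment> \<open>The approximating cylinders need not form a partition. Where the description is
    not unique its value is arbitrary, but still a function of the window, and such points lie in
    some symmetric difference.\<close>
  define f' where "f' x = (THE A. A \<in> P \<and> x \<in> C A)" for x
  have f'_cong: "f' x = f' y" if "\<And>i. \<bar>i\<bar> \<le> int m \<Longrightarrow> x i = y i" for x y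
  proof -
    have "A \<in> P \<and> x \<in> C A \<longleftrightarrow> A \<in> P \<and> y \<in> C A" for A using cylinderD[OF m, of A x y] that by auto
    then show ?thesis by (simp add: f'_def)
  qed
  \<comment> \<open>The window word is turned back into a sequence; by \<open>f'_cong\<close> its
    values outside the window do not affect \<open>f'\<close>.\<close>
  define F where "F w = f' (\<lambda>i. w ! nat (i + int m))" for w
  have f'F: "f' x = F (word_at x (- int m) (2 * m + 1))" for x
    unfolding F_def by (rule f'_cong) (auto simp: abs_le_iff nat_less_iff)
  let ?E = "\<lambda>x. if f x = f' x then None else Some (f x)"
  have f'_simple: "simple_function M f'"
    using simple_function_compose[OF simple_word_at, of F "- int m" "2 * m + 1"]
    by (simp add: comp_def f'F[abs_def])
  have E: "simple_function M ?E"
    using simple_function_compose[OF simple_function_Pair[OF f f'_simple],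
        of "\<lambda>(u, v). if u = v then None else Some u"] by (simp add: comp_def)
  have CM: "C A \<in> sets M" if "A \<in> P" for A using cylinder_borel[OF C(1)[OF that]] sets_M by simp
  have sub: "{x \<in> space M. ?E x \<noteq> None} \<subseteq> (\<Union>A\<in>P. (A - C A) \<union> (C A - A))"
  proof
    fix x assume "x \<in> {x \<in> space M. ?E x \<noteq> None}"
    then have ne: "f x \<noteq> f' x" by (auto split: if_splits)
    show "x \<in> (\<Union>A\<in>P. (A - C A) \<union> (C A - A))"
    proof (rule ccontr)
      assume "x \<notin> (\<Union>A\<in>P. (A - C A) \<union> (C A - A))"
      then have "A \<in> P \<and> x \<in> C A \<longleftrightarrow> A \<in> P \<and> x \<in> A" for A by auto
      then have "f' x = f x" by (simp add: f'_def f_def)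
      with ne show False by simp
    qed
  qed
  have "prob {x \<in> space M. ?E x \<noteq> None} \<le> prob (\<Union>A\<in>P. (A - C A) \<union> (C A - A))"
    using sub CM PM fin by (intro finite_measure_mono sets.finite_UN) auto
  also have "\<dots> \<le> (\<Sum>A\<in>P. prob ((A - C A) \<union> (C A - A)))"
    using CM PM fin by (intro finite_measure_subadditive_finite) auto
  also have "\<dots> \<le> (\<Sum>A\<in>P. d\<^sup>2 / (1 + real (card P)))"
    using C(2) by (intro sum_mono) (simp add: less_imp_le)
  also have "\<dots> \<le> d\<^sup>2" by (simp add: field_simps)
  finally have "ent M ?E \<le> d * (1 + 2 * real (card P))"
    using fP d fin by (intro ent_error_le[OF E]) auto
  then show "ks_entropy_partition M shift P \<le> shift_entropy + e"
    using ks_entropy_partition_le_error[where F = F and f' = f' and m = m, OF f f'F, of e] d(3) fib by simp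
qed

text \<open>This is the Kolmogorov--Sinai theorem for the time-zero partition; it replaces the
  supremum over partitions by the entropy rate of words.\<close>

lemma ks_entropy_eq: "ks_entropy M shift = ereal shift_entropy"
proof (rule antisym)
  show "ks_entropy M shift \<le> ereal shift_entropy"
    unfolding ks_entropy_def using ks_entropy_partition_le by (intro SUP_least) auto
  let ?P = "fibers M (\<lambda>x. x 0)"
  have "finite_partition M ?P"
    unfolding finite_partition_def
  proof (intro conjI)
    show "finite ?P" using simple_functionD(1)[OF simple_coordinate] by (simp add: fibers_def)
    show "?P \<subseteq> sets M" using simple_functionD(2)[OF simple_coordinate] by (auto simp: fibers_def)
    show "partition_on (space M) ?P"
      by (rule partition_onI) (auto simp: fibers_def disjnt_def)
  qed
  then show "ereal shift_entropy \<le> ks_entropy M shift"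
    unfolding ks_entropy_def by (intro SUP_upper) simp
qed

end

section \<open>Variational estimates\<close>

text \<open>Apply \<open>ln t \<le> t - 1\<close> with \<open>t = exp (s w) / (Z * p w)\<close> and
  sum against \<open>p\<close>; the right-hand sides cancel because both weight families have total
  mass 1.\<close>

lemma gibbs_inequality:
  fixes p s :: "'b \<Rightarrow> real"
  assumes S: "finite S" "S \<noteq> {}" and p: "\<And>w. w \<in> S \<Longrightarrow> 0 \<le> p w" "(\<Sum>w\<in>S. p w) = 1"
  shows "(\<Sum>w\<in>S. p w * s w) - (\<Sum>w\<in>S. p w * ln (p w)) \<le> ln (\<Sum>w\<in>S. exp (s w))"
proof -
  define Z where "Z = (\<Sum>w\<in>S. exp (s w))"
  have Z: "0 < Z" unfolding Z_def using S by (intro sum_pos) auto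
  have "p w * s w - p w * ln (p w) - p w * ln Z \<le> exp (s w) / Z - p w" if "w \<in> S" for w
  proof (cases "p w = 0")
    case False
    then have pw: "0 < p w" using p(1)[OF that] by simp
    have "ln (exp (s w) / (Z * p w)) \<le> exp (s w) / (Z * p w) - 1"
      using Z pw by (intro ln_le_minus_one) simp
    moreover have "ln (exp (s w) / (Z * p w)) = s w - ln (p w) - ln Z"
      using Z pw by (simp add: ln_div ln_mult)
    ultimately have "p w * (s w - ln (p w) - ln Z) \<le> p w * (exp (s w) / (Z * p w) - 1)"
      using pw by (intro mult_left_mono) auto
    also have "\<dots> = exp (s w) / Z - p w" using Z pw by (simp add: right_diff_distrib)
    finally show ?thesis by (simp add: algebra_simps)
  qed (use Z in simp)
  then have "(\<Sum>w\<in>S. p w * s w - p w * ln (p w) - p w * ln Z) \<le> (\<Sum>w\<in>S. exp (s w) / Z - p w)"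
    by (rule sum_mono)
  also have "\<dots> = 0" using Z p(2) by (simp add: sum_subtractf sum_divide_distrib[symmetric] Z_def)
  finally show ?thesis
    using p(2) by (simp add: sum_subtractf sum_distrib_right[symmetric] Z_def)
qed

lemma (in prob_space) expectation_simple:
  fixes s :: "'b \<Rightarrow> real"
  assumes X: "simple_function M X" and S: "finite S" "X ` space M \<subseteq> S"
  shows "expectation (\<lambda>x. s (X x)) = (\<Sum>w\<in>S. prob (X -` {w} \<inter> space M) * s w)"
proof -
  have ev: "X -` {w} \<inter> space M \<in> events" for w using X by (rule simple_functionD)
  have "s (X x) = (\<Sum>w\<in>S. s w * indicator (X -` {w} \<inter> space M) x)" if "x \<in> space M" for x
  proof -
    have "(\<Sum>w\<in>S. s w * indicator (X -` {w} \<inter> space M) x) = (\<Sum>w\<in>S. if w = X x then s w else 0)"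
      using that by (intro sum.cong) (auto simp: indicator_def)
    then show ?thesis using that S by auto
  qed
  then have "expectation (\<lambda>x. s (X x)) = expectation (\<lambda>x. \<Sum>w\<in>S. s w * indicator (X -` {w} \<inter> space M) x)"
    by (intro Bochner_Integration.integral_cong) auto
  also have "\<dots> = (\<Sum>w\<in>S. s w * prob (X -` {w} \<inter> space M))"
    using ev by (subst Bochner_Integration.integral_sum) (auto simp: emeasure_eq_measure)
  finally show ?thesis by (simp add: mult.commute)
qed

lemma (in prob_space) sum_prob_fibers:
  assumes X: "simple_function M X" and S: "finite S" "X ` space M \<subseteq> S"
  shows "(\<Sum>w\<in>S. prob (X -` {w} \<inter> space M)) = 1"
  using expectation_simple[OF assms, of "\<lambda>_. 1"] by (simp add: prob_space)

lemma (in prob_space) integrable_bounded: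
  fixes f :: "'a \<Rightarrow> real"
  assumes "f \<in> borel_measurable M" "\<And>x. \<bar>f x\<bar> \<le> K" shows "integrable M f"
  using assms by (intro integrable_const_bound[where B = K]) auto

context shift_invariant
begin

lemma integral_funpow_shift:
  fixes \<phi> :: "(int \<Rightarrow> 'a) \<Rightarrow> real"
  assumes "\<phi> \<in> borel_measurable borel"
  shows "(\<integral>x. \<phi> ((shift ^^ i) x) \<partial>M) = integral\<^sup>L M \<phi>"
proof -
  have "\<phi> \<in> borel_measurable M" using assms by (simp add: measurable_cong_sets[OF sets_M refl])
  then have "integral\<^sup>L (distr M M (shift ^^ i)) \<phi> = (\<integral>x. \<phi> ((shift ^^ i) x) \<partial>M)"
    by (intro integral_distr[OF funpow_measurable])
  then show ?thesis by (simp add: distr_funpow)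
qed

text \<open>By invariance the Birkhoff sum has \<open>n\<close> times the integral of
  \<open>\<phi>\<close>, and the entropy rate is at most the word entropy over \<open>n\<close>.
  Gibbs' inequality for the word distribution yields the partition function, while \<open>c\<close>
  absorbs the influence of letters outside the word.\<close>

lemma free_energy_le:
  fixes \<phi> :: "(int \<Rightarrow> 'a) \<Rightarrow> real"
  assumes \<phi>: "\<phi> \<in> borel_measurable borel" "\<And>x. \<bar>\<phi> x\<bar> \<le> K" and n: "0 < n"
    and s: "\<And>x. (\<Sum>i<n. \<phi> ((shift ^^ i) x)) \<le> s (word_at x 0 n) + c"
  shows "real n * (shift_entropy + integral\<^sup>L M \<phi>) \<le> ln (\<Sum>w | length w = n. exp (s w)) + c"
proof -
  let ?S = "{w :: 'a list. length w = n}"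
  let ?X = "\<lambda>x. word_at x 0 n"
  define p where "p w = prob (?X -` {w} \<inter> space M)" for w
  have fin: "finite ?S" using finite_lists_length_eq[OF finite[of "UNIV :: 'a set"], of n] by simp
  have "replicate n undefined \<in> ?S" by simp
  then have ne: "?S \<noteq> {}" by blast
  have sub: "?X ` space M \<subseteq> ?S" by auto
  have \<phi>M: "\<phi> \<in> borel_measurable M" using \<phi>(1) by (simp add: measurable_cong_sets[OF sets_M refl])
  have meas: "(\<lambda>x. \<phi> ((shift ^^ i) x)) \<in> borel_measurable M" for i
    by (rule measurable_compose[OF funpow_measurable \<phi>M])
  have int: "integrable M (\<lambda>x. \<phi> ((shift ^^ i) x))" for i
    by (rule integrable_bounded[OF meas \<phi>(2)])
  have "real n * integral\<^sup>L M \<phi> = (\<Sum>i<n. \<integral>x. \<phi> ((shift ^^ i) x) \<partial>M)"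
    by (simp add: integral_funpow_shift[OF \<phi>(1)])
  also have "\<dots> = (\<integral>x. (\<Sum>i<n. \<phi> ((shift ^^ i) x)) \<partial>M)"
    using int by (intro Bochner_Integration.integral_sum[symmetric]) auto
  also have "\<dots> \<le> (\<integral>x. s (?X x) + c \<partial>M)"
  proof (intro integral_mono s Bochner_Integration.integrable_sum int Bochner_Integration.integrable_add)
    show "integrable M (\<lambda>x. s (?X x))"
    proof (rule integrable_bounded)
      show "(\<lambda>x. s (?X x)) \<in> borel_measurable M"
        using borel_measurable_simple_function[OF simple_function_compose[OF simple_word_at, of s]] by (simp add: comp_def)
      show "\<bar>s (?X x)\<bar> \<le> (\<Sum>w\<in>?S. \<bar>s w\<bar>)" for x
        using fin by (intro member_le_sum) auto
    qed
  qed auto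
  also have "\<dots> = (\<Sum>w\<in>?S. p w * (s w + c))"
    unfolding p_def by (rule expectation_simple[OF simple_word_at fin sub])
  also have "\<dots> = (\<Sum>w\<in>?S. p w * s w) + c"
    using sum_prob_fibers[OF simple_word_at fin sub]
    by (simp add: ring_distribs sum.distrib sum_distrib_right[symmetric] p_def)
  finally have "real n * integral\<^sup>L M \<phi> \<le> (\<Sum>w\<in>?S. p w * s w) + c" .
  moreover have "real n * shift_entropy \<le> - (\<Sum>w\<in>?S. p w * ln (p w))"
    using shift_entropy_le[OF n] n ent_eq_sum[OF fin sub] by (simp add: p_def field_simps)
  moreover have "(\<Sum>w\<in>?S. p w * s w) - (\<Sum>w\<in>?S. p w * ln (p w)) \<le> ln (\<Sum>w\<in>?S. exp (s w))"
    using sum_prob_fibers[OF simple_word_at fin sub]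
    by (intro gibbs_inequality[OF fin ne]) (simp_all add: p_def)
  ultimately show ?thesis by (simp add: distrib_left)
qed

end

section \<open>Measures generated by independent blocks\<close>

text \<open>Second countability of the alphabet makes measurability into the sequence space a matter
  of single coordinates, through \<open>measurable_coordinatewise_then_product\<close>.\<close>

instance sign :: second_countable_topology
proof
  show "\<exists>B :: sign set set. countable B \<and> open = generate_topology B"
    by (intro exI[of _ UNIV]) (auto simp: fun_eq_iff open_discrete countable_finite intro: generate_topology.Basis)
qed

lemma shift_borel_measurable: "(shift ^^ k) \<in> borel \<rightarrow>\<^sub>M (borel :: (int \<Rightarrow> sign) measure)"
  unfolding funpow_shift
  by (intro measurable_coordinatewise_then_product borel_measurable_continuous_onI continuous_on_product_coordinates)

lemma sum_lists_Suc:
  "(\<Sum>ws | set ws \<subseteq> W \<and> length ws = Suc r. g ws) = (\<Sum>w\<in>W. \<Sum>ws | set ws \<subseteq> W \<and> length ws = r. g (w # ws))"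
proof -
  have "{ws. set ws \<subseteq> W \<and> length ws = Suc r} = (\<lambda>(w, ws). w # ws) ` (W \<times> {ws. set ws \<subseteq> W \<and> length ws = r})"
    by (auto simp: length_Suc_conv image_iff)
  moreover have "inj_on (\<lambda>(w, ws). w # ws) (W \<times> {ws. set ws \<subseteq> W \<and> length ws = r})"
    by (auto simp: inj_on_def)
  ultimately show ?thesis
    by (simp add: sum.reindex sum.cartesian_product case_prod_unfold)
qed

text \<open>The logarithm of a product splits, and the factors without logarithm sum to 1: up to
  sign, the entropy of \<open>r\<close> independent draws is \<open>r\<close> times that of
  one.\<close>

lemma sum_prod_list_ln:
  fixes p :: "'b \<Rightarrow> real"
  assumes p: "(\<Sum>w\<in>W. p w) = 1" "\<And>w. w \<in> W \<Longrightarrow> 0 < p w"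
  shows "(\<Sum>ws | set ws \<subseteq> W \<and> length ws = r. prod_list (map p ws) * ln (prod_list (map p ws)))
      = real r * (\<Sum>w\<in>W. p w * ln (p w))"
proof -
  let ?P = "\<lambda>ws. prod_list (map p ws)"
  have pos: "0 < ?P ws" if "set ws \<subseteq> W" for ws
    using that p(2) by (induction ws) auto
  have empty: "{ws. set ws \<subseteq> W \<and> length ws = 0} = {[]}" by auto
  have one: "(\<Sum>ws | set ws \<subseteq> W \<and> length ws = r. ?P ws) = 1" for r
  proof (induction r)
    case 0
    show ?case by (simp only: empty) simp
  next
    case (Suc r)
    then show ?case by (simp add: sum_lists_Suc sum_distrib_left[symmetric] p(1))
  qed
  show "(\<Sum>ws | set ws \<subseteq> W \<and> length ws = r. ?P ws * ln (?P ws)) = real r * (\<Sum>w\<in>W. p w * ln (p w))"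
  proof (induction r)
    case 0
    show ?case by (simp only: empty) simp
  next
    case (Suc r)
    let ?S = "{ws. set ws \<subseteq> W \<and> length ws = r}"
    have "(\<Sum>ws | set ws \<subseteq> W \<and> length ws = Suc r. ?P ws * ln (?P ws))
        = (\<Sum>w\<in>W. \<Sum>ws\<in>?S. (p w * ln (p w)) * ?P ws + p w * (?P ws * ln (?P ws)))"
      unfolding sum_lists_Suc
    proof (intro sum.cong refl)
      fix w ws assume w: "w \<in> W" and ws: "ws \<in> ?S"
      have "ln (p w * ?P ws) = ln (p w) + ln (?P ws)"
        using p(2)[OF w] pos[of ws] ws by (simp add: ln_mult)
      then show "?P (w # ws) * ln (?P (w # ws)) = (p w * ln (p w)) * ?P ws + p w * (?P ws * ln (?P ws))"
        by (simp add: algebra_simps)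
    qed
    also have "\<dots> = (\<Sum>w\<in>W. p w * ln (p w) + p w * (real r * (\<Sum>w\<in>W. p w * ln (p w))))"
      by (simp only: sum.distrib sum_distrib_left[symmetric] one Suc.IH mult_1_right)
    also have "\<dots> = real (Suc r) * (\<Sum>w\<in>W. p w * ln (p w))"
      by (simp only: sum.distrib sum_distrib_right[symmetric] p(1)) (simp add: algebra_simps)
    finally show ?case .
  qed
qed

section \<open>The stationary measure of an independent block code\<close>

text \<open>Block \<open>j\<close> occupies the coordinates from \<open>j * int L\<close> on. For
  words of length \<open>L\<close> this is \<open>biconcat\<close>, but each coordinate visibly
  depends on a single block, which makes measurability immediate.\<close>

definition periodic_code :: "nat \<Rightarrow> (int \<Rightarrow> 'a list) \<Rightarrow> int \<Rightarrow> 'a" where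
  "periodic_code L \<omega> n = \<omega> (n div int L) ! nat (n mod int L)"

lemma periodic_code_nth:
  assumes "i < L" shows "periodic_code L \<omega> (j * int L + int i) = \<omega> j ! i"
  using assms by (simp add: periodic_code_def)

lemma shift_periodic_code:
  assumes "0 < L" shows "(shift ^^ L) (periodic_code L \<omega>) = periodic_code L (\<lambda>j. \<omega> (j + 1))"
  using assms by (simp add: funpow_shift periodic_code_def fun_eq_iff)

locale block_system =
  fixes W :: "sign list set" and L :: nat and s :: "sign list \<Rightarrow> real"
  assumes finite_W: "finite W" and W_ne: "W \<noteq> {}" and length_W: "w \<in> W \<Longrightarrow> length w = L" and L_pos: "0 < L"
begin

definition "Z = (\<Sum>w\<in>W. exp (s w))"

text \<open>Gibbs weights are the equality case of \<open>gibbs_inequality\<close>: entropy plus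
  mean of \<open>s\<close> is exactly \<open>ln Z\<close>.\<close>

definition "p w = exp (s w) / Z"

definition "block = point_measure W (\<lambda>w. ennreal (p w))"

definition "blocks = PiM (UNIV :: int set) (\<lambda>_. block)"

text \<open>The law of a block sequence is in general only invariant under
  \<open>shift ^^ L\<close>; a uniform random starting point inside a block restores invariance
  under \<open>shift\<close>.\<close>

definition "phase = uniform_count_measure {..<L}"

definition "emb q = (shift ^^ snd q) (periodic_code L (fst q))"

definition "\<nu> = distr (blocks \<Otimes>\<^sub>M phase) borel emb"

lemma Z_pos: "0 < Z"
  unfolding Z_def using finite_W W_ne by (intro sum_pos) auto

lemma p_pos: "0 < p w"
  using Z_pos by (simp add: p_def)

lemma sum_p: "(\<Sum>w\<in>W. p w) = 1"
  using Z_pos by (simp add: p_def sum_divide_distrib[symmetric] Z_def)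

lemma space_block: "space block = W" and sets_block: "sets block = Pow W"
  by (simp_all add: block_def space_point_measure sets_point_measure)

sublocale block: prob_space block
  unfolding block_def using finite_W p_pos sum_p by (intro prob_space_point_measure) (auto simp: less_imp_le)

sublocale blocks: product_prob_space "\<lambda>_. block" "UNIV :: int set"
  by unfold_locales

sublocale seqs: prob_space blocks
  unfolding blocks_def by (rule blocks.P.prob_space_axioms)

sublocale phase: prob_space phase
  unfolding phase_def using L_pos by (intro prob_space_uniform_count_measure) auto

sublocale pair: pair_prob_space blocks phase
  by unfold_locales

lemma space_phase: "space phase = {..<L}" and sets_phase: "sets phase = Pow {..<L}"
  by (simp_all add: phase_def space_uniform_count_measure sets_uniform_count_measure)

lemma space_blocks: "space blocks = {\<omega>. \<forall>j. \<omega> j \<in> W}"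
  by (auto simp: blocks_def space_PiM space_block PiE_iff)

lemma component_measurable: "(\<lambda>\<omega>. \<omega> j) \<in> blocks \<rightarrow>\<^sub>M block"
  unfolding blocks_def by (rule measurable_component_singleton) simp

lemma code_measurable: "periodic_code L \<in> borel_measurable blocks"
proof (rule measurable_coordinatewise_then_product)
  fix n
  have "(\<lambda>w. w ! nat (n mod int L)) \<in> borel_measurable block" by (simp add: block_def)
  from measurable_compose[OF component_measurable this]
  show "(\<lambda>\<omega>. periodic_code L \<omega> n) \<in> borel_measurable blocks" by (simp add: periodic_code_def)
qed

lemma emb_measurable: "emb \<in> borel_measurable (blocks \<Otimes>\<^sub>M phase)"
  unfolding emb_def[abs_def]
proof (rule measurable_compose_countable'[where I = "{..<L}" and g = snd])
  have "(blocks \<Otimes>\<^sub>M phase \<rightarrow>\<^sub>M phase) = (blocks \<Otimes>\<^sub>M phase \<rightarrow>\<^sub>M count_space {..<L})"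
    by (rule measurable_cong_sets) (simp_all add: sets_phase)
  then show "snd \<in> blocks \<Otimes>\<^sub>M phase \<rightarrow>\<^sub>M count_space {..<L}"
    using measurable_snd[of blocks phase] by (rule subst)
  show "(\<lambda>q. (shift ^^ k) (periodic_code L (fst q))) \<in> borel_measurable (blocks \<Otimes>\<^sub>M phase)" for k
    by (intro measurable_compose[OF _ shift_borel_measurable] measurable_compose[OF measurable_fst code_measurable])
qed simp

lemma sets_\<nu>: "sets \<nu> = sets borel" and space_\<nu>: "space \<nu> = UNIV"
  by (simp_all add: \<nu>_def)

sublocale \<nu>: prob_space \<nu>
  unfolding \<nu>_def by (rule pair.prob_space_distr[OF emb_measurable])

lemma integral_\<nu>:
  fixes f :: "(int \<Rightarrow> sign) \<Rightarrow> real"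
  assumes f: "f \<in> borel_measurable borel" "\<And>x. \<bar>f x\<bar> \<le> K"
  shows "integral\<^sup>L \<nu> f = (\<integral>\<omega>. (\<Sum>k<L. f ((shift ^^ k) (periodic_code L \<omega>))) \<partial>blocks) / real L"
proof -
  have meas: "(\<lambda>q. f (emb q)) \<in> borel_measurable (blocks \<Otimes>\<^sub>M phase)"
    by (rule measurable_compose[OF emb_measurable f(1)])
  have "integral\<^sup>L \<nu> f = (\<integral>q. f (emb q) \<partial>(blocks \<Otimes>\<^sub>M phase))"
    unfolding \<nu>_def by (rule integral_distr[OF emb_measurable f(1)])
  also have "\<dots> = (\<integral>\<omega>. (\<integral>k. f (emb (\<omega>, k)) \<partial>phase) \<partial>blocks)"
    by (rule pair.integral_fst'[symmetric]) (rule pair.integrable_bounded[OF meas f(2)])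
  also have "\<dots> = (\<integral>\<omega>. (\<Sum>k<L. f ((shift ^^ k) (periodic_code L \<omega>))) / real L \<partial>blocks)"
    by (simp add: phase_def integral_uniform_count_measure emb_def)
  finally show ?thesis by simp
qed

lemma distr_blocks_shift:
  "(\<lambda>\<omega> j. \<omega> (j + 1)) \<in> blocks \<rightarrow>\<^sub>M blocks" "distr blocks blocks (\<lambda>\<omega> j. \<omega> (j + 1)) = blocks"
proof -
  show "(\<lambda>\<omega> j. \<omega> (j + 1)) \<in> blocks \<rightarrow>\<^sub>M blocks"
    using component_measurable measurable_space[OF component_measurable]
    unfolding blocks_def by (intro measurable_PiM_single') (auto simp: PiE_iff)
  show "distr blocks blocks (\<lambda>\<omega> j. \<omega> (j + 1)) = blocks"
    using distr_PiM_reindex[of UNIV "\<lambda>_. block" "\<lambda>j :: int. j + 1" UNIV] block.prob_space_axioms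
    by (simp add: blocks_def inj_on_def restrict_def)
qed

text \<open>Shifting turns phase \<open>k\<close> into phase \<open>k + 1\<close>, so the two phase
  averages differ only in the terms at 0 and \<open>L\<close>. These agree because moving by a whole
  block reindexes independent identically distributed blocks.\<close>

lemma \<nu>_shift_invariant: "shift_invariant \<nu>"
proof
  have shift1: "shift \<in> borel \<rightarrow>\<^sub>M (borel :: (int \<Rightarrow> sign) measure)"
    using shift_borel_measurable[of 1] by simp
  then show meas: "shift \<in> \<nu> \<rightarrow>\<^sub>M \<nu>"
    by (simp add: measurable_cong_sets[OF sets_\<nu> sets_\<nu>])
  show "sets \<nu> = sets borel" by (rule sets_\<nu>)
  show "distr \<nu> \<nu> shift = \<nu>"
  proof (rule measure_eqI)
    fix A assume "A \<in> sets (distr \<nu> \<nu> shift)"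
    then have A: "A \<in> sets borel" by (simp add: sets_\<nu>)
    let ?f = "indicator A :: (int \<Rightarrow> sign) \<Rightarrow> real"
    let ?c = "periodic_code L"
    have f: "?f \<in> borel_measurable borel" "\<And>x. \<bar>?f x\<bar> \<le> 1"
      using A by (auto simp: indicator_def)
    have sf: "(\<lambda>x. ?f (shift x)) \<in> borel_measurable borel" "\<And>x. \<bar>?f (shift x)\<bar> \<le> 1"
      using measurable_compose[OF shift1 f(1)] f(2) by auto
    have cm: "(\<lambda>\<omega>. ?f ((shift ^^ k) (?c \<omega>))) \<in> borel_measurable blocks" for k
      by (rule measurable_compose[OF measurable_compose[OF code_measurable shift_borel_measurable] f(1)])
    have int: "integrable blocks (\<lambda>\<omega>. ?f ((shift ^^ k) (?c \<omega>)))" for k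
      by (rule seqs.integrable_bounded[OF cm f(2)])
    have int': "integrable blocks (\<lambda>\<omega>. ?f (shift ((shift ^^ k) (?c \<omega>))))" for k
      using int[of "Suc k"] by simp
    have "(\<integral>\<omega>. ?f ((shift ^^ L) (?c \<omega>)) \<partial>blocks) = (\<integral>\<omega>. ?f (?c \<omega>) \<partial>distr blocks blocks (\<lambda>\<omega> j. \<omega> (j + 1)))"
      unfolding shift_periodic_code[OF L_pos] using cm[of 0]
      by (intro integral_distr[symmetric, OF distr_blocks_shift(1)]) simp
    then have eq: "(\<integral>\<omega>. ?f ((shift ^^ L) (?c \<omega>)) \<partial>blocks) = (\<integral>\<omega>. ?f ((shift ^^ 0) (?c \<omega>)) \<partial>blocks)"
      by (simp add: distr_blocks_shift(2))
    have "(\<Sum>k<L. \<integral>\<omega>. ?f ((shift ^^ Suc k) (?c \<omega>)) \<partial>blocks) = (\<Sum>k<L. \<integral>\<omega>. ?f ((shift ^^ k) (?c \<omega>)) \<partial>blocks)"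
      using sum.lessThan_Suc_shift[of "\<lambda>k. \<integral>\<omega>. ?f ((shift ^^ k) (?c \<omega>)) \<partial>blocks" L]
        sum.lessThan_Suc[of "\<lambda>k. \<integral>\<omega>. ?f ((shift ^^ k) (?c \<omega>)) \<partial>blocks" L] eq by linarith
    then have "(\<integral>x. ?f (shift x) \<partial>\<nu>) = integral\<^sup>L \<nu> ?f"
      unfolding integral_\<nu>[OF f] integral_\<nu>[OF sf] using int int'
      by (subst (1 2) Bochner_Integration.integral_sum) auto
    moreover have "(\<integral>x. ?f (shift x) \<partial>\<nu>) = measure \<nu> (shift -` A \<inter> space \<nu>)"
    proof -
      have "(\<lambda>x. ?f (shift x)) = indicator (shift -` A)" by (auto simp: indicator_def)
      then show ?thesis by (simp add: space_\<nu>)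
    qed
    ultimately show "emeasure (distr \<nu> \<nu> shift) A = emeasure \<nu> A"
      using A meas by (simp add: emeasure_distr sets_\<nu> \<nu>.emeasure_eq_measure space_\<nu>)
  qed simp
qed

sublocale \<nu>: shift_invariant \<nu>
  by (rule \<nu>_shift_invariant)

text \<open>Counting starts at block 1, since a phase \<open>k > 0\<close> cuts off the first
  \<open>k\<close> letters of block 0.\<close>

definition "block_word r \<omega> = map (\<lambda>j. \<omega> (int j + 1)) [0..<r]"

lemma simple_block_word: "simple_function blocks (block_word r)"
  unfolding block_word_def[abs_def]
proof (rule simple_function_map_upt)
  have "simple_function block (\<lambda>w. w)" using finite_W by (simp add: block_def)
  then show "simple_function blocks (\<lambda>\<omega>. \<omega> (int j + 1))" for j
    by (rule simple_function_compose_measurable[OF component_measurable])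
qed

lemma measure_block_word:
  assumes ws: "set ws \<subseteq> W" "length ws = r"
  shows "measure blocks (block_word r -` {ws} \<inter> space blocks) = prod_list (map p ws)"
proof -
  let ?J = "(\<lambda>j. int j + 1) ` {..<r}"
  have inj: "inj_on (\<lambda>j. int j + 1) {..<r}" by (auto simp: inj_on_def)
  have "block_word r -` {ws} \<inter> space blocks = {\<omega> \<in> space blocks. \<forall>i\<in>?J. \<omega> i \<in> {ws ! nat (i - 1)}}"
  proof -
    have "block_word r \<omega> = ws \<longleftrightarrow> (\<forall>j<r. \<omega> (int j + 1) = ws ! j)" for \<omega>
      unfolding list_eq_iff_nth_eq[of "block_word r \<omega>"] by (simp add: block_word_def ws(2))
    then show ?thesis by auto
  qed
  moreover have nth: "ws ! j \<in> W" if "j < r" for j using ws that nth_mem[of j ws] by auto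
  ultimately have "emeasure blocks (block_word r -` {ws} \<inter> space blocks) = (\<Prod>i\<in>?J. emeasure block {ws ! nat (i - 1)})"
    unfolding blocks_def by (simp only:) (intro blocks.emeasure_PiM_Collect, auto simp: sets_block)
  also have "\<dots> = (\<Prod>j<r. emeasure block {ws ! j})" by (subst prod.reindex[OF inj]) simp
  also have "\<dots> = (\<Prod>j<r. ennreal (p (ws ! j)))"
    using nth finite_W by (intro prod.cong) (auto simp: block_def emeasure_point_measure_finite)
  also have "\<dots> = ennreal (\<Prod>j<r. p (ws ! j))" using p_pos by (intro prod_ennreal) (simp add: less_imp_le)
  also have "(\<Prod>j<r. p (ws ! j)) = prod_list (map p ws)"
    unfolding prod.list_conv_set_nth using ws(2) by (intro prod.cong) auto
  finally have "emeasure blocks (block_word r -` {ws} \<inter> space blocks) = ennreal (prod_list (map p ws))" .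
  moreover have "0 \<le> prod_list (map p ws)"
    using p_pos by (intro prod_list_nonneg) (auto simp: less_imp_le)
  ultimately show ?thesis by (simp add: measure_def)
qed

lemma ent_block_word: "ent blocks (block_word r) = real r * (ln Z - (\<Sum>w\<in>W. p w * s w))"
proof -
  let ?S = "{ws. set ws \<subseteq> W \<and> length ws = r}"
  have "ent blocks (block_word r) = - (\<Sum>ws\<in>?S. prod_list (map p ws) * ln (prod_list (map p ws)))"
    using finite_lists_length_eq[OF finite_W] measure_block_word
    by (subst ent_eq_sum[where S = ?S]) (auto simp: block_word_def space_blocks)
  also have "\<dots> = real r * - (\<Sum>w\<in>W. p w * ln (p w))"
    using sum_prod_list_ln[OF sum_p p_pos, of r] by simp
  also have "- (\<Sum>w\<in>W. p w * ln (p w)) = ln Z - (\<Sum>w\<in>W. p w * s w)"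
  proof -
    have "p w * ln (p w) = p w * s w - p w * ln Z" for w
      using Z_pos by (simp add: p_def ln_div field_simps)
    then show ?thesis
      by (simp add: sum_subtractf sum_distrib_right[symmetric] sum_p)
  qed
  finally show ?thesis .
qed

text \<open>Given the phase, the symbols seen in a window determine all blocks inside it; so passing
  to the stationary measure costs at most the entropy of the phase.\<close>

lemma ent_block_word_le:
  "ent blocks (block_word r) \<le> ent \<nu> (\<lambda>x. word_at x 0 (L * (r + 1))) + ln (real L)"
proof -
  let ?Q = "blocks \<Otimes>\<^sub>M phase" and ?N = "L * (r + 1)"
  let ?X = "\<lambda>q. word_at (emb q) 0 ?N"
  have X: "simple_function ?Q ?X"
    by (rule simple_function_compose_measurable[OF _ \<nu>.simple_word_at])
      (use emb_measurable in \<open>simp add: measurable_cong_sets[OF refl sets_\<nu>]\<close>)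
  have phase: "simple_function phase (\<lambda>k. k)"
    by (simp add: phase_def uniform_count_measure_def)
  have snd: "simple_function ?Q snd"
    by (rule simple_function_compose_measurable[OF measurable_snd phase])
  have fst_distr: "distr ?Q blocks fst = blocks" by (rule phase.distr_pair_fst)
  have "ent blocks (block_word r) = ent ?Q (\<lambda>q. block_word r (fst q))"
    using ent_distr[OF measurable_fst simple_block_word, of phase r] by (simp add: fst_distr comp_def)
  also have "\<dots> \<le> ent ?Q (\<lambda>q. (?X q, snd q))"
  proof (rule pair.ent_le[OF simple_function_Pair[OF X snd],
        where f = "\<lambda>(w, k). map (\<lambda>j. take L (drop ((j + 1) * L - k) w)) [0..<r]"])
    fix q assume q: "q \<in> space ?Q"
    then have k: "snd q < L" and \<omega>: "\<And>j. length (fst q j) = L"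
      by (auto simp: space_pair_measure space_phase space_blocks length_W)
    have "fst q (int j + 1) = take L (drop ((j + 1) * L - snd q) (?X q))" if j: "j < r" for j
    proof (rule nth_equalityI)
      \<comment> \<open>After the shift, block \<open>j + 1\<close> begins at
        \<open>(j + 1) * L - snd q\<close>, and it ends inside the window because
        \<open>j < r\<close>.\<close>
      have "(j + 2) * L \<le> (r + 1) * L" using j by (intro mult_right_mono) auto
      then have le: "(j + 1) * L - snd q + L \<le> ?N" by (simp add: algebra_simps)
      then show "length (fst q (int j + 1)) = length (take L (drop ((j + 1) * L - snd q) (?X q)))"
        by (simp add: \<omega>)
      fix i assume "i < length (fst q (int j + 1))"
      then have i: "i < L" by (simp add: \<omega>)
      have "snd q \<le> (j + 1) * L" using k by (simp add: trans_le_add1 less_imp_le)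
      then have "int ((j + 1) * L - snd q) + int (snd q) = (int j + 1) * int L" by (simp add: algebra_simps)
      then have "emb q (int ((j + 1) * L - snd q + i)) = periodic_code L (fst q) ((int j + 1) * int L + int i)"
        by (simp add: emb_def funpow_shift algebra_simps)
      then show "fst q (int j + 1) ! i = take L (drop ((j + 1) * L - snd q) (?X q)) ! i"
        using i le by (simp add: periodic_code_nth)
    qed
    then show "block_word r (fst q) = (case (?X q, snd q) of (w, k) \<Rightarrow> map (\<lambda>j. take L (drop ((j + 1) * L - k) w)) [0..<r])"
      by (simp add: block_word_def)
  qed
  also have "\<dots> \<le> ent ?Q ?X + ent ?Q snd" by (rule pair.ent_Pair_le[OF X snd])
  also have "ent ?Q ?X = ent \<nu> (\<lambda>x. word_at x 0 ?N)"
  proof -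
    have "simple_function (borel :: (int \<Rightarrow> sign) measure) (\<lambda>x. word_at x 0 ?N)"
      using \<nu>.simple_word_at[of 0 ?N] by (simp add: simple_function_def sets_\<nu> space_\<nu>)
    from ent_distr[OF emb_measurable this] show ?thesis by (simp add: \<nu>_def comp_def)
  qed
  also have "ent ?Q snd \<le> ln (real (card (snd ` space ?Q)))" by (rule pair.ent_le_ln_card[OF snd])
  also have "\<dots> \<le> ln (real L)"
  proof -
    have "snd ` space ?Q \<subseteq> {..<L}" by (auto simp: space_pair_measure space_phase)
    then have "card (snd ` space ?Q) \<le> L" using card_mono[of "{..<L}"] by fastforce
    moreover have "0 < card (snd ` space ?Q)"
      using pair.not_empty simple_functionD(1)[OF snd] by (simp add: card_gt_0_iff)
    ultimately show ?thesis by simp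
  qed
  finally show ?thesis by simp
qed

text \<open>A window of length \<open>L * (r + 1)\<close> carries at least the entropy of
  \<open>r\<close> blocks minus \<open>ln L\<close>; per letter, the incomplete block and the phase
  cost only a term of order \<open>1 / Suc r\<close>.\<close>

lemma shift_entropy_\<nu>_ge: "(ln Z - (\<Sum>w\<in>W. p w * s w)) / real L \<le> \<nu>.shift_entropy"
proof (rule LIMSEQ_le)
  define h where "h = ln Z - (\<Sum>w\<in>W. p w * s w)"
  have "strict_mono (\<lambda>r. L * (r + 1))" using L_pos by (simp add: strict_mono_def)
  from LIMSEQ_subseq_LIMSEQ[OF \<nu>.shift_entropy_lim this]
  show "(\<lambda>r. ent \<nu> (\<lambda>x. word_at x 0 (L * (r + 1))) / real (L * (r + 1))) \<longlonglongrightarrow> \<nu>.shift_entropy"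
    by (simp add: comp_def)
  have "(\<lambda>r. h / real L - (h + ln (real L)) / real L * (1 / real (Suc r))) \<longlonglongrightarrow> h / real L - (h + ln (real L)) / real L * 0"
    by (intro tendsto_intros LIMSEQ_Suc[OF lim_1_over_n])
  then show "(\<lambda>r. h / real L - (h + ln (real L)) / real L * (1 / real (Suc r))) \<longlonglongrightarrow> (ln Z - (\<Sum>w\<in>W. p w * s w)) / real L"
    by (simp add: h_def)
  show "\<exists>N. \<forall>r\<ge>N. h / real L - (h + ln (real L)) / real L * (1 / real (Suc r))
      \<le> ent \<nu> (\<lambda>x. word_at x 0 (L * (r + 1))) / real (L * (r + 1))"
  proof (intro exI allI impI)
    fix r
    have "h / l - k / l * (1 / a) = (a * h - k) / (l * a)" if "0 < l" "0 < a" for l k a :: real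
      using that by (simp add: field_simps)
    from this[of "real L" "real (Suc r)"]
    have "h / real L - (h + ln (real L)) / real L * (1 / real (Suc r))
        = (real (Suc r) * h - (h + ln (real L))) / (real L * real (Suc r))"
      using L_pos by simp
    also have "\<dots> = (real r * h - ln (real L)) / real (L * (r + 1))"
      by (simp add: algebra_simps)
    also have "\<dots> \<le> ent \<nu> (\<lambda>x. word_at x 0 (L * (r + 1))) / real (L * (r + 1))"
      using ent_block_word_le[of r] ent_block_word[of r] by (intro divide_right_mono) (auto simp: h_def)
    finally show "h / real L - (h + ln (real L)) / real L * (1 / real (Suc r))
      \<le> ent \<nu> (\<lambda>x. word_at x 0 (L * (r + 1))) / real (L * (r + 1))" .
  qed
qed

text \<open>Averaging over the phases sums \<open>\<phi>\<close> along block 0, whose law is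
  \<open>p\<close>. The tolerance \<open>c\<close> covers the influence of the neighbouring
  blocks.\<close>

lemma integral_\<nu>_ge:
  fixes \<phi> :: "(int \<Rightarrow> sign) \<Rightarrow> real"
  assumes \<phi>: "\<phi> \<in> borel_measurable borel" "\<And>x. \<bar>\<phi> x\<bar> \<le> K"
    and s: "\<And>x. word_at x 0 L \<in> W \<Longrightarrow> s (word_at x 0 L) - c \<le> (\<Sum>i<L. \<phi> ((shift ^^ i) x))"
  shows "((\<Sum>w\<in>W. p w * s w) - c) / real L \<le> integral\<^sup>L \<nu> \<phi>"
proof -
  have cm: "(\<lambda>\<omega>. \<phi> ((shift ^^ k) (periodic_code L \<omega>))) \<in> borel_measurable blocks" for k
    by (rule measurable_compose[OF measurable_compose[OF code_measurable shift_borel_measurable] \<phi>(1)])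
  have sm: "s \<in> borel_measurable block" by (simp add: block_def)
  have int_s: "integrable blocks (\<lambda>\<omega>. s (\<omega> 0))"
  proof (rule seqs.integrable_const_bound)
    show "(\<lambda>\<omega>. s (\<omega> 0)) \<in> borel_measurable blocks" by (rule measurable_compose[OF component_measurable sm])
    have "\<bar>s w\<bar> \<le> (\<Sum>w\<in>W. \<bar>s w\<bar>)" if "w \<in> W" for w
      using finite_W that by (intro member_le_sum) auto
    then show "AE \<omega> in blocks. norm (s (\<omega> 0)) \<le> (\<Sum>w\<in>W. \<bar>s w\<bar>)"
      by (intro AE_I2) (simp add: space_blocks)
  qed
  have "(\<Sum>w\<in>W. p w * s w) = integral\<^sup>L block s"
    using finite_W p_pos by (simp add: block_def lebesgue_integral_point_measure_finite less_imp_le)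
  also have "\<dots> = integral\<^sup>L (distr blocks block (\<lambda>\<omega>. \<omega> 0)) s"
    using blocks.PiM_component[of 0] by (simp add: blocks_def)
  also have "\<dots> = (\<integral>\<omega>. s (\<omega> 0) \<partial>blocks)" by (rule integral_distr[OF component_measurable sm])
  finally have "(\<Sum>w\<in>W. p w * s w) - c = (\<integral>\<omega>. s (\<omega> 0) - c \<partial>blocks)"
    using int_s by (simp add: seqs.prob_space)
  also have "\<dots> \<le> (\<integral>\<omega>. (\<Sum>k<L. \<phi> ((shift ^^ k) (periodic_code L \<omega>))) \<partial>blocks)"
  proof (rule integral_mono)
    show "integrable blocks (\<lambda>\<omega>. s (\<omega> 0) - c)" using int_s by simp
    show "integrable blocks (\<lambda>\<omega>. \<Sum>k<L. \<phi> ((shift ^^ k) (periodic_code L \<omega>)))"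
      by (intro Bochner_Integration.integrable_sum seqs.integrable_bounded[OF cm \<phi>(2)])
    fix \<omega> assume "\<omega> \<in> space blocks"
    then have \<omega>: "\<omega> 0 \<in> W" by (simp add: space_blocks)
    have "word_at (periodic_code L \<omega>) 0 L = \<omega> 0"
      using length_W[OF \<omega>] periodic_code_nth[of _ L \<omega> 0] by (intro nth_equalityI) auto
    then show "s (\<omega> 0) - c \<le> (\<Sum>k<L. \<phi> ((shift ^^ k) (periodic_code L \<omega>)))"
      using s[of "periodic_code L \<omega>"] \<omega> by simp
  qed
  finally show ?thesis
    unfolding integral_\<nu>[OF \<phi>] by (rule divide_right_mono) simp
qed

lemma emeasure_\<nu>_eq_1:
  assumes R: "R \<in> sets borel" "\<And>\<omega> k. (\<And>j. \<omega> j \<in> W) \<Longrightarrow> k < L \<Longrightarrow> (shift ^^ k) (periodic_code L \<omega>) \<in> R"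
  shows "emeasure \<nu> R = 1"
proof -
  have "emb -` R \<inter> space (blocks \<Otimes>\<^sub>M phase) = space (blocks \<Otimes>\<^sub>M phase)"
    using R(2) by (auto simp: space_pair_measure space_phase space_blocks emb_def)
  then show ?thesis
    unfolding \<nu>_def emeasure_distr[OF emb_measurable R(1)] by (simp add: pair.emeasure_space_1)
qed

end

section \<open>Lower bound for restricted pressures\<close>

lemma invariant_measures_UNIV_iff: "M \<in> invariant_measures UNIV \<longleftrightarrow> shift_invariant M"
proof -
  have "shift_invariant M \<longleftrightarrow> sets M = sets borel \<and> prob_space M \<and> shift \<in> M \<rightarrow>\<^sub>M M \<and> distr M M shift = M"
    by (auto simp: shift_invariant_def shift_invariant_axioms_def measure_preserving_def measure_preserving_axioms_def)
  then show ?thesis by (simp add: invariant_measures_def sets_restrict_space)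
qed

text \<open>When the entropy and integral bounds are added, the mean of \<open>s\<close> cancels.
  The set \<open>R\<close> is left open because the estimate serves the residual set and the
  concatenation set alike.\<close>

lemma pressure_over_ge:
  fixes \<phi> :: "(int \<Rightarrow> sign) \<Rightarrow> real"
  assumes W: "finite W" "W \<noteq> {}" "\<And>w. w \<in> W \<Longrightarrow> length w = L" "0 < L"
    and \<phi>: "\<phi> \<in> borel_measurable borel" "\<And>x. \<bar>\<phi> x\<bar> \<le> K"
    and s: "\<And>x. word_at x 0 L \<in> W \<Longrightarrow> s (word_at x 0 L) - c \<le> (\<Sum>i<L. \<phi> ((shift ^^ i) x))"
    and R: "R \<in> sets borel" "\<And>\<omega> k. (\<And>j. \<omega> j \<in> W) \<Longrightarrow> k < L \<Longrightarrow> (shift ^^ k) (periodic_code L \<omega>) \<in> R"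
  shows "ereal ((ln (\<Sum>w\<in>W. exp (s w)) - c) / real L)
    \<le> pressure_over {M \<in> invariant_measures UNIV. emeasure M R = 1} \<phi>"
proof -
  interpret block_system W L s by unfold_locales (use W in auto)
  have "(ln Z - c) / real L \<le> \<nu>.shift_entropy + integral\<^sup>L \<nu> \<phi>"
    using shift_entropy_\<nu>_ge integral_\<nu>_ge[OF \<phi> s] by (simp add: diff_divide_distrib)
  then have "ereal ((ln (\<Sum>w\<in>W. exp (s w)) - c) / real L) \<le> ks_entropy \<nu> shift + ereal (integral\<^sup>L \<nu> \<phi>)"
    by (simp add: \<nu>.ks_entropy_eq Z_def)
  moreover have "\<nu> \<in> {M \<in> invariant_measures UNIV. emeasure M R = 1}"
    using \<nu>_shift_invariant emeasure_\<nu>_eq_1[OF R] by (simp add: invariant_measures_UNIV_iff)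
  ultimately show ?thesis unfolding pressure_over_def by (rule SUP_upper2[rotated])
qed

section \<open>Approximation by measures on the residual set\<close>

lemma compact_sign_sequences: "compact (UNIV :: (int \<Rightarrow> sign) set)"
  using compact_coded_shift[of dyck] by (simp add: coded_shift_dyck)

lemma continuous_bounded:
  fixes \<phi> :: "(int \<Rightarrow> sign) \<Rightarrow> real"
  assumes "continuous_on UNIV \<phi>"
  obtains K where "\<And>x. \<bar>\<phi> x\<bar> \<le> K"
  using compact_imp_bounded[OF compact_continuous_image[OF assms compact_sign_sequences]]
  by (auto simp: bounded_iff)

text \<open>Compactness gives one radius for all points: finitely many cylinders cover the space,
  and on each \<open>\<phi>\<close> stays within \<open>e / 2\<close> of its value at the
  centre.\<close>

lemma continuous_uniform:
  fixes \<phi> :: "(int \<Rightarrow> sign) \<Rightarrow> real"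
  assumes \<phi>: "continuous_on UNIV \<phi>" and e: "0 < e"
  obtains m where "\<And>x y. (\<And>i. \<bar>i\<bar> \<le> int m \<Longrightarrow> x i = y i) \<Longrightarrow> \<bar>\<phi> x - \<phi> y\<bar> \<le> e"
proof -
  have "\<exists>m. \<forall>y. (\<forall>i. \<bar>i\<bar> \<le> int m \<longrightarrow> y i = x i) \<longrightarrow> \<bar>\<phi> y - \<phi> x\<bar> < e / 2" for x
  proof -
    have "open (\<phi> -` ball (\<phi> x) (e / 2))" by (intro open_vimage \<phi>) simp
    moreover have "x \<in> \<phi> -` ball (\<phi> x) (e / 2)" using e by simp
    ultimately obtain m where "\<And>y. (\<And>i. \<bar>i\<bar> \<le> int m \<Longrightarrow> y i = x i) \<Longrightarrow> y \<in> \<phi> -` ball (\<phi> x) (e / 2)"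
      using open_contains_cylinder by blast
    then show ?thesis by (auto simp: dist_real_def abs_minus_commute)
  qed
  then obtain m where m: "\<And>x y. (\<And>i. \<bar>i\<bar> \<le> int (m x) \<Longrightarrow> y i = x i) \<Longrightarrow> \<bar>\<phi> y - \<phi> x\<bar> < e / 2" by metis
  define C where "C x = {y :: int \<Rightarrow> sign. \<forall>i\<in>{- int (m x)..int (m x)}. y i = x i}" for x
  have "C x = (\<Inter>i\<in>{- int (m x)..int (m x)}. (\<lambda>y. y i) -` {x i})" for x by (auto simp: C_def)
  then have "open (C x)" for x
    by (simp only:) (intro open_INT ballI open_vimage open_discrete continuous_on_product_coordinates, simp)
  moreover have "UNIV \<subseteq> (\<Union>x\<in>UNIV. C x)" by (auto simp: C_def)
  ultimately obtain D where D: "finite D" "UNIV \<subseteq> (\<Union>x\<in>D. C x)"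
    using compactE_image[OF compact_sign_sequences, of UNIV C] by (metis UNIV_I)
  define M where "M = Max (insert 0 (m ` D))"
  show ?thesis
  proof (rule that[of M])
    fix x y :: "int \<Rightarrow> sign" assume xy: "\<And>i. \<bar>i\<bar> \<le> int M \<Longrightarrow> x i = y i"
    obtain z where z: "z \<in> D" "x \<in> C z" using D(2) by blast
    have "m z \<le> M" using D(1) z(1) by (auto simp: M_def intro: Max_ge)
    then have eq: "x i = z i" "y i = z i" if "\<bar>i\<bar> \<le> int (m z)" for i
      using that z(2) xy[of i] by (auto simp: C_def abs_le_iff)
    have "\<bar>\<phi> x - \<phi> z\<bar> < e / 2" "\<bar>\<phi> y - \<phi> z\<bar> < e / 2" using m[of z x] m[of z y] eq by blast+
    then show "\<bar>\<phi> x - \<phi> y\<bar> \<le> e" by linarith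
  qed
qed

definition birkhoff :: "((int \<Rightarrow> 'a) \<Rightarrow> real) \<Rightarrow> nat \<Rightarrow> (int \<Rightarrow> 'a) \<Rightarrow> real" where
  "birkhoff \<phi> n x = (\<Sum>i<n. \<phi> ((shift ^^ i) x))"

text \<open>At times away from both ends the window of radius \<open>m\<close> stays inside the
  common word, at cost \<open>e\<close>; the at most \<open>2 * m\<close> other times cost at most
  \<open>2 * K\<close> more each.\<close>

lemma birkhoff_variation:
  assumes K: "\<And>x. \<bar>\<phi> x\<bar> \<le> K" and e: "0 \<le> e"
    and m: "\<And>x y. (\<And>i. \<bar>i\<bar> \<le> int m \<Longrightarrow> x i = y i) \<Longrightarrow> \<bar>\<phi> x - \<phi> y\<bar> \<le> e"
    and eq: "word_at x 0 n = word_at y 0 n"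
  shows "\<bar>birkhoff \<phi> n x - birkhoff \<phi> n y\<bar> \<le> real n * e + 4 * real m * K"
proof -
  have K0: "0 \<le> K" using K[of x] by linarith
  have xy: "x j = y j" if "0 \<le> j" "j < int n" for j
    using arg_cong[OF eq, of "\<lambda>w. w ! nat j"] that by simp
  let ?B = "{i \<in> {..<n}. i < m \<or> n \<le> i + m}"
  have "\<bar>\<phi> ((shift ^^ i) x) - \<phi> ((shift ^^ i) y)\<bar> \<le> e + (if i \<in> ?B then 2 * K else 0)" if i: "i < n" for i
  proof (cases "i \<in> ?B")
    case True
    then show ?thesis using K[of "(shift ^^ i) x"] K[of "(shift ^^ i) y"] e by auto
  next
    case False
    then have "\<bar>\<phi> ((shift ^^ i) x) - \<phi> ((shift ^^ i) y)\<bar> \<le> e"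
      using i by (intro m) (auto simp: funpow_shift intro!: xy)
    then show ?thesis using False by (simp only: if_False add_0_right)
  qed
  then have "(\<Sum>i<n. \<bar>\<phi> ((shift ^^ i) x) - \<phi> ((shift ^^ i) y)\<bar>) \<le> (\<Sum>i<n. e + (if i \<in> ?B then 2 * K else 0))"
    by (intro sum_mono) auto
  also have "\<dots> = real n * e + real (card ?B) * (2 * K)"
    by (simp only: sum.distrib sum.inter_filter[symmetric, OF finite_lessThan] mem_Collect_eq)
      (simp add: sum.If_cases Int_def conj_ac)
  also have "\<dots> \<le> real n * e + real (2 * m) * (2 * K)"
  proof -
    have "card ?B \<le> card ({..<m} \<union> {n - m..<n})" by (intro card_mono) auto
    also have "\<dots> \<le> card {..<m} + card {n - m..<n}" by (rule card_Un_le)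
    finally have "card ?B \<le> 2 * m" by simp
    then have "real (card ?B) \<le> real (2 * m)" by (simp only: of_nat_le_iff)
    then show ?thesis using K0 by (intro add_left_mono mult_right_mono) simp_all
  qed
  finally have "(\<Sum>i<n. \<bar>\<phi> ((shift ^^ i) x) - \<phi> ((shift ^^ i) y)\<bar>) \<le> real n * e + 4 * real m * K"
    by simp
  then show ?thesis
    unfolding birkhoff_def sum_subtractf[symmetric] by (rule order_trans[OF sum_abs])
qed

definition drift_concat :: "(int \<Rightarrow> sign) set" where
  "drift_concat = {(shift ^^ k) (periodic_code L \<omega>) | k L \<omega>. 0 < L \<and> (\<forall>j. length (\<omega> j) = L) \<and>
     ((\<forall>j. 0 < wsum (\<omega> j)) \<or> (\<forall>j. wsum (\<omega> j) < 0))}"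

lemma drift_concat_X_con: "x \<in> drift_concat \<Longrightarrow> x \<notin> X_con dyck"
proof -
  assume "x \<in> drift_concat"
  then obtain k L \<omega> where x: "x = (shift ^^ k) (periodic_code L \<omega>)" and L: "0 < L"
    and len: "\<And>j. length (\<omega> j) = L" and drift: "(\<forall>j. 0 < wsum (\<omega> j)) \<or> (\<forall>j. wsum (\<omega> j) < 0)"
    by (auto simp: drift_concat_def)
  have word: "word_at x (- int k + j * int L) L = \<omega> j" for j
  proof (rule nth_equalityI)
    fix i assume "i < length (word_at x (- int k + j * int L) L)"
    then show "word_at x (- int k + j * int L) L ! i = \<omega> j ! i"
      using periodic_code_nth[of i L \<omega> j] by (simp add: x funpow_shift algebra_simps)
  qed (simp add: len)
  have "walk x (- int k + (j + 1) * int L) = walk x (- int k + j * int L) + wsum (\<omega> j)" for j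
    using walk_add[of x "- int k + j * int L" L] unfolding word by (simp add: algebra_simps)
  then have "walk_mins x = {}"
    using drift L by (intro no_walk_mins[of "int L" x "- int k"]) auto
  then show ?thesis by (simp add: X_con_dyck_eq)
qed

text \<open>The appended letter \<open>a\<close> makes a sum that weakly has the sign of
  \<open>a\<close> strictly so. It adds one term to the Birkhoff sum, hence the loss
  \<open>K\<close>; the weights are unchanged because \<open>butlast\<close> removes it.\<close>

lemma pressure_over_ge_signed:
  fixes \<phi> :: "(int \<Rightarrow> sign) \<Rightarrow> real"
  assumes A: "A \<subseteq> {w. length w = n}" "A \<noteq> {}" "\<And>w. w \<in> A \<Longrightarrow> 0 \<le> step a * wsum w"
    and \<phi>: "\<phi> \<in> borel_measurable borel" "\<And>x. \<bar>\<phi> x\<bar> \<le> K"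
    and s: "\<And>x. s (word_at x 0 n) - c \<le> birkhoff \<phi> n x"
    and R: "R \<in> sets borel" "drift_concat \<subseteq> R"
  shows "ereal ((ln (\<Sum>w\<in>A. exp (s w)) - (c + K)) / real (n + 1))
    \<le> pressure_over {M \<in> invariant_measures UNIV. emeasure M R = 1} \<phi>"
proof -
  let ?W = "(\<lambda>w. w @ [a]) ` A"
  have "finite {w :: sign list. length w = n}"
    using finite_lists_length_eq[OF finite[of "UNIV :: sign set"], of n] by simp
  then have fin: "finite A" using A(1) by (rule rev_finite_subset)
  have "inj_on (\<lambda>w. w @ [a]) A" by (simp add: inj_on_def)
  then have sum: "(\<Sum>w\<in>?W. exp (s (butlast w))) = (\<Sum>w\<in>A. exp (s w))" by (simp add: sum.reindex)
  have "ereal ((ln (\<Sum>w\<in>?W. exp (s (butlast w))) - (c + K)) / real (n + 1))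
    \<le> pressure_over {M \<in> invariant_measures UNIV. emeasure M R = 1} \<phi>"
  proof (rule pressure_over_ge[OF _ _ _ _ \<phi>])
    show "finite ?W" "?W \<noteq> {}" using fin A(2) by auto
    show "length w = n + 1" if "w \<in> ?W" for w using that A(1) by auto
    show "s (butlast (word_at x 0 (n + 1))) - (c + K) \<le> (\<Sum>i<n + 1. \<phi> ((shift ^^ i) x))" for x
      using s[of x] \<phi>(2)[of "(shift ^^ n) x"] by (simp add: birkhoff_def word_at_Suc)
    show "R \<in> sets borel" by fact
    fix \<omega> :: "int \<Rightarrow> sign list" and k assume \<omega>: "\<And>j. \<omega> j \<in> ?W"
    have "0 < step a * wsum (\<omega> j)" for j
    proof -
      obtain w where w: "w \<in> A" "\<omega> j = w @ [a]" using \<omega>[of j] by auto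
      then show ?thesis using A(3)[OF w(1)] by (cases a) auto
    qed
    then have "(\<forall>j. 0 < wsum (\<omega> j)) \<or> (\<forall>j. wsum (\<omega> j) < 0)" by (cases a) (auto simp: zero_less_mult_iff)
    moreover have "length (\<omega> j) = n + 1" for j using \<omega>[of j] A(1) by auto
    ultimately have "(shift ^^ k) (periodic_code (n + 1) \<omega>) \<in> drift_concat"
      unfolding drift_concat_def by fastforce
    then show "(shift ^^ k) (periodic_code (n + 1) \<omega>) \<in> R" using R(2) by blast
  qed simp
  then show ?thesis by (simp only: sum)
qed

text \<open>The larger summand is at least half of the total. Its positivity is recorded because it
  shows that the chosen class of words is nonempty.\<close>

lemma ln_half_le:
  assumes "0 < a + b" "0 \<le> a" "0 \<le> (b::real)"
  shows "(0 < a \<and> ln (a + b) - ln 2 \<le> ln a) \<or> (0 < b \<and> ln (a + b) - ln 2 \<le> ln b)"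
proof -
  have half: "0 < x \<and> ln (a + b) - ln 2 \<le> ln x" if "a + b \<le> 2 * x" for x
  proof -
    have "0 < x" using that assms(1) by linarith
    then have "ln (a + b) \<le> ln (2 * x)" using that assms(1) by simp
    also have "\<dots> = ln 2 + ln x" using \<open>0 < x\<close> by (simp add: ln_mult)
    finally show ?thesis using \<open>0 < x\<close> by linarith
  qed
  have "a + b \<le> 2 * a \<or> a + b \<le> 2 * b" by linarith
  then show ?thesis using half by blast
qed

text \<open>For words of length \<open>n\<close> the loss is \<open>c\<close> once in the upper and
  once in the lower estimate, \<open>K\<close> for the extra letter and \<open>ln 2\<close> for the
  discarded half. Per letter only \<open>2 * d\<close> survives as \<open>n\<close> grows.\<close>

lemma free_energy_le_pressure_over:
  fixes \<phi> :: "(int \<Rightarrow> sign) \<Rightarrow> real"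
  assumes M: "shift_invariant \<mu>"
    and \<phi>: "continuous_on UNIV \<phi>" and R: "R \<in> sets borel" "drift_concat \<subseteq> R"
  shows "ks_entropy \<mu> shift + ereal (integral\<^sup>L \<mu> \<phi>)
    \<le> pressure_over {M \<in> invariant_measures UNIV. emeasure M R = 1} \<phi>" (is "_ \<le> ?P")
proof -
  interpret \<mu>: shift_invariant \<mu> by fact
  obtain K where K: "\<And>x. \<bar>\<phi> x\<bar> \<le> K" using continuous_bounded[OF \<phi>] by blast
  have \<phi>m: "\<phi> \<in> borel_measurable borel" using \<phi> by (rule borel_measurable_continuous_onI)
  define B where "B = \<mu>.shift_entropy + integral\<^sup>L \<mu> \<phi>"
  have "ereal B \<le> ?P + ereal e" if e: "0 < e" for e
  proof -
    define d where "d = e / 2"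
    have d: "0 < d" using e by (simp add: d_def)
    obtain m where m: "\<And>x y. (\<And>i. \<bar>i\<bar> \<le> int m \<Longrightarrow> x i = y i) \<Longrightarrow> \<bar>\<phi> x - \<phi> y\<bar> \<le> d"
      using continuous_uniform[OF \<phi> d] by blast
    have bound: "ereal ((real n * B - (2 * (real n * d + 4 * real m * K) + K + ln 2)) / real (n + 1)) \<le> ?P"
      if n: "0 < n" for n
    proof -
      define c where "c = real n * d + 4 * real m * K"
      \<comment> \<open>Continuing by \<open>Plus\<close> is an arbitrary choice: any sequence
        through \<open>w\<close> has a Birkhoff sum within \<open>c\<close> of this one.\<close>
      define pad where "pad w = (\<lambda>i. if 0 \<le> i \<and> i < int (length w) then w ! nat i else Plus)" for w
      define s where "s w = birkhoff \<phi> n (pad w)" for w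
      have var: "\<bar>birkhoff \<phi> n x - s (word_at x 0 n)\<bar> \<le> c" for x
        unfolding s_def c_def
      proof (rule birkhoff_variation[OF K less_imp_le[OF d] m])
        show "word_at x 0 n = word_at (pad (word_at x 0 n)) 0 n"
          by (rule nth_equalityI) (simp_all add: pad_def)
      qed
      \<comment> \<open>Words of sum 0 count with the nonnegative ones; the appended
        \<open>Plus\<close> makes their sums positive too.\<close>
      let ?A = "\<lambda>b. {w :: sign list. length w = n \<and> (0 \<le> wsum w \<longleftrightarrow> b)}"
      let ?Z = "\<lambda>b. \<Sum>w\<in>?A b. exp (s w)"
      have fin: "finite {w :: sign list. length w = n}"
        using finite_lists_length_eq[OF finite[of "UNIV :: sign set"], of n] by simp
      have "(\<Sum>i<n. \<phi> ((shift ^^ i) x)) \<le> s (word_at x 0 n) + c" for x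
        using var[of x] by (simp add: birkhoff_def abs_le_iff)
      from \<mu>.free_energy_le[OF \<phi>m K n this]
      have up: "real n * B \<le> ln (\<Sum>w | length w = n. exp (s w)) + c" by (simp add: B_def)
      have "(\<Sum>w | length w = n. exp (s w)) = (\<Sum>w\<in>?A True \<union> ?A False. exp (s w))"
        by (rule sum.cong) auto
      also have "\<dots> = ?Z True + ?Z False"
        by (rule sum.union_disjoint) (auto intro: finite_subset[OF _ fin])
      finally have Z: "(\<Sum>w | length w = n. exp (s w)) = ?Z True + ?Z False" .
      have "replicate n Plus \<in> {w. length w = n}" by simp
      then have "{w :: sign list. length w = n} \<noteq> {}" by blast
      then have "0 < (\<Sum>w | length w = n. exp (s w))" using fin by (intro sum_pos) simp_all
      then have pos: "0 < ?Z True + ?Z False" unfolding Z .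
      have nonneg: "0 \<le> ?Z b" for b by (intro sum_nonneg) simp
      have "\<exists>b. 0 < ?Z b \<and> ln (\<Sum>w | length w = n. exp (s w)) - ln 2 \<le> ln (?Z b)"
        unfolding Z using ln_half_le[OF pos nonneg nonneg] by blast
      then obtain b where b: "0 < ?Z b" "ln (\<Sum>w | length w = n. exp (s w)) - ln 2 \<le> ln (?Z b)" by blast
      have "ereal ((ln (?Z b) - (c + K)) / real (n + 1)) \<le> ?P"
      proof (rule pressure_over_ge_signed[where a = "if b then Plus else Minus", OF _ _ _ \<phi>m K _ R])
        show "?A b \<noteq> {}" using b(1) by (metis less_irrefl sum.empty)
        show "s (word_at x 0 n) - c \<le> birkhoff \<phi> n x" for x using var[of x] by (simp add: abs_le_iff)
      qed auto
      moreover have "(real n * B - (2 * c + K + ln 2)) / real (n + 1) \<le> (ln (?Z b) - (c + K)) / real (n + 1)"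
        using up b(2) by (intro divide_right_mono) auto
      ultimately show ?thesis unfolding c_def by (meson ereal_less_eq(3) order_trans)
    qed
    have "(\<lambda>n. (real n * B - (2 * (real n * d + 4 * real m * K) + K + ln 2)) / real (n + 1)) \<longlonglongrightarrow> B - 2 * d"
      by real_asymp
    then have "(\<lambda>n. ereal ((real n * B - (2 * (real n * d + 4 * real m * K) + K + ln 2)) / real (n + 1)))
        \<longlonglongrightarrow> ereal (B - 2 * d)" by (rule tendsto_ereal)
    then have "ereal (B - 2 * d) \<le> ?P"
      by (rule Lim_bounded[where M = 1]) (use bound in auto)
    moreover have "ereal B \<le> p + ereal e" if "ereal (B - e) \<le> p" for p
      using that by (cases p) auto
    ultimately show ?thesis by (simp add: d_def)
  qed
  note le = this
  have "ereal B \<le> ?P" by (rule ereal_le_epsilon2) (use le in blast)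
  then show ?thesis by (simp add: \<mu>.ks_entropy_eq B_def)
qed

section \<open>Entropy of concatenations of Dyck words\<close>

lemma biconcat_periodic_code:
  assumes len: "\<And>j. length (\<omega> j) = L" and L: "0 < L"
  shows "biconcat \<omega> = periodic_code L \<omega>"
proof
  fix n
  have sp: "start_pos \<omega> j = j * int L" for j
  proof (rule int_all_induct[where P = "\<lambda>j. start_pos \<omega> j = j * int L"])
    show "start_pos \<omega> j = j * int L \<longleftrightarrow> start_pos \<omega> (j + 1) = (j + 1) * int L" for j
      unfolding start_pos_Suc len distrib_right by simp
  qed simp
  have "\<omega> j \<noteq> []" for j using len[of j] L by auto
  then obtain j i where ji: "i < length (\<omega> j)" "n = start_pos \<omega> j + int i"
    using start_pos_cover[of \<omega> n] by blast
  then show "biconcat \<omega> n = periodic_code L \<omega> n"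
    using biconcat_nth[of i \<omega> j] periodic_code_nth[of i L \<omega> j] len[of j] by (simp add: sp)
qed

lemma periodic_code_X_con:
  assumes "\<And>j. \<omega> j \<in> dyck" "\<And>j. length (\<omega> j) = L" "k < L"
  shows "(shift ^^ k) (periodic_code L \<omega>) \<in> X_con dyck"
proof -
  have "biconcat \<omega> = periodic_code L \<omega>" using assms by (intro biconcat_periodic_code) auto
  then have "pointed_rep dyck ((shift ^^ k) (periodic_code L \<omega>)) (\<omega>, k)"
    using assms by (simp add: pointed_rep_def)
  then show ?thesis by (auto simp: X_con_def)
qed

fun flip :: "sign \<Rightarrow> sign" where
  "flip Plus = Minus"
| "flip Minus = Plus"

lemma flip_flip: "flip (flip a) = a"
  by (cases a) auto

lemma wsum_map_flip: "wsum (map flip w) = - wsum w"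
proof (induction w)
  case (Cons a w)
  then show ?case by (cases a) auto
qed simp

lemma CARD_sign: "card (UNIV :: sign set) = 2"
proof -
  have "(UNIV :: sign set) = {Plus, Minus}" using sign.exhaust by auto
  then have "card (UNIV :: sign set) = card {Plus, Minus}" by (rule arg_cong)
  then show ?thesis by simp
qed

definition balanced :: "nat \<Rightarrow> sign list set" where
  "balanced n = {v. length v = 2 * n \<and> wsum v = 0}"

lemma finite_balanced: "finite (balanced n)"
  using finite_lists_length_eq[OF finite[of "UNIV :: sign set"], of "2 * n"]
  by (rule rev_finite_subset) (auto simp: balanced_def)

text \<open>By pigeonhole some value of the sum is attained by many words of length \<open>n\<close>;
  pairing them with flipped ones balances the sum.\<close>

lemma card_balanced: "(2 ^ n / (2 * real n + 1))\<^sup>2 \<le> real (card (balanced n))"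
proof -
  define A where "A t = {w. length w = n \<and> wsum w = t}" for t
  have finA: "finite (A t)" for t
    using finite_lists_length_eq[OF finite[of "UNIV :: sign set"], of n]
    by (rule rev_finite_subset) (auto simp: A_def)
  have "\<exists>t. 2 ^ n / (2 * real n + 1) \<le> real (card (A t))"
  proof (rule ccontr)
    assume "\<not> ?thesis"
    then have lt: "real (card (A t)) < 2 ^ n / (2 * real n + 1)" for t by (auto simp: not_le)
    have "- int n \<le> wsum w \<and> wsum w \<le> int n" if "length w = n" for w
      using wsum_bounds[of w] that by linarith
    then have "{w :: sign list. length w = n} = (\<Union>t\<in>{- int n..int n}. A t)"
      by (auto simp: A_def)
    then have "card {w :: sign list. length w = n} \<le> (\<Sum>t\<in>{- int n..int n}. card (A t))"
      using card_UN_le[of "{- int n..int n}" A] by simp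
    moreover have "card {w :: sign list. length w = n} = 2 ^ n"
      using card_lists_length_eq[OF finite[of "UNIV :: sign set"], of n] by (simp add: CARD_sign)
    ultimately have "2 ^ n \<le> (\<Sum>t\<in>{- int n..int n}. real (card (A t)))"
      by (metis of_nat_le_iff of_nat_numeral of_nat_power of_nat_sum)
    also have "\<dots> < (\<Sum>t\<in>{- int n..int n}. 2 ^ n / (2 * real n + 1))"
      using lt by (intro sum_strict_mono) auto
    also have "\<dots> = 2 ^ n" by (simp add: field_simps)
    finally show False by simp
  qed
  then obtain t where t: "2 ^ n / (2 * real n + 1) \<le> real (card (A t))" by blast
  have "inj_on (\<lambda>(u, v). u @ map flip v) (A t \<times> A t)"
  proof (rule inj_onI, clarify)
    fix u v u' v' assume *: "u \<in> A t" "v \<in> A t" "u' \<in> A t" "v' \<in> A t" "u @ map flip v = u' @ map flip v'"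
    then have "u = u'" "map flip v = map flip v'" by (auto simp: A_def)
    moreover have "inj flip" by (metis flip_flip injI)
    ultimately show "u = u' \<and> v = v'" by (simp add: inj_map_eq_map)
  qed
  then have "card (A t) * card (A t) = card ((\<lambda>(u, v). u @ map flip v) ` (A t \<times> A t))"
    by (simp add: card_image card_cartesian_product)
  also have "\<dots> \<le> card (balanced n)"
    by (intro card_mono finite_balanced) (auto simp: A_def balanced_def wsum_map_flip)
  finally have "real (card (A t)) * real (card (A t)) \<le> real (card (balanced n))"
    by (metis of_nat_le_iff of_nat_mult)
  moreover have "(2 ^ n / (2 * real n + 1)) * (2 ^ n / (2 * real n + 1)) \<le> real (card (A t)) * real (card (A t))"
    using t by (intro mult_mono) auto
  ultimately show ?thesis by (simp add: power2_eq_square)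
qed

text \<open>Complete blocks have sum 0, so a prefix of the concatenation has the sum of a prefix of
  a single block, which is at least minus the block length.\<close>

lemma balanced_concat:
  assumes "set vs \<subseteq> balanced n"
  shows "length (concat vs) = 2 * n * length vs" "wsum (concat vs) = 0"
    "- (2 * int n) \<le> wsum (take k (concat vs))"
proof -
  show "length (concat vs) = 2 * n * length vs" "wsum (concat vs) = 0"
    using assms by (induction vs) (auto simp: balanced_def algebra_simps)
  show "- (2 * int n) \<le> wsum (take k (concat vs))"
    using assms
  proof (induction vs arbitrary: k)
    case (Cons v vs)
    then have v: "length v = 2 * n" "wsum v = 0" by (auto simp: balanced_def)
    show ?case
    proof (cases "k \<le> length v")
      case True
      then show ?thesis using wsum_bounds[of "take k v"] v by simp
    next
      case False
      then show ?thesis using Cons.IH[of "k - length v"] Cons.prems v by simp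
    qed
  qed simp
qed

lemma inj_on_concat_equal_length:
  assumes "\<And>v. v \<in> V \<Longrightarrow> length v = l"
  shows "inj_on concat {vs. set vs \<subseteq> V \<and> length vs = r}"
proof (rule inj_onI)
  fix vs vs' assume "vs \<in> {vs. set vs \<subseteq> V \<and> length vs = r}" "vs' \<in> {vs. set vs \<subseteq> V \<and> length vs = r}"
    "concat vs = concat vs'"
  then show "vs = vs'"
  proof (induction vs arbitrary: vs' r)
    case (Cons v vs)
    then obtain v' vs'' where vs': "vs' = v' # vs''" by (cases vs') auto
    have "length v = length v'" using Cons.prems vs' assms by auto
    then have "v = v'" "concat vs = concat vs''" using Cons.prems(3) vs' by auto
    then show ?case using Cons.IH[of "r - 1" vs''] Cons.prems vs' by auto
  qed auto
qed

text \<open>The \<open>n\<close> balanced words form a payload of quadratic length, while the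
  padding is linear: the total is \<open>2 * (n + 1)\<^sup>2\<close>. Joining many words before
  padding is what makes the padding negligible.\<close>

lemma pressure_over_zero_ge:
  assumes n: "0 < n"
  shows "ereal (real n * (real n * ln 2 - ln (2 * real n + 1)) / (real n + 1)\<^sup>2)
    \<le> pressure_over {M \<in> invariant_measures UNIV. emeasure M (X_con dyck) = 1} (\<lambda>_. 0)"
proof -
  \<comment> \<open>Prefix sums of the payload are at least \<open>- (2 * n)\<close>, so an ascent
    of \<open>2 * n + 1\<close> stays above 0; the payload has sum 0, so the descent is equally
    long.\<close>
  define f where "f vs = replicate (2 * n + 1) Plus @ concat vs @ replicate (2 * n + 1) Minus" for vs
  let ?V = "{vs. set vs \<subseteq> balanced n \<and> length vs = n}"
  let ?W = "f ` ?V"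
  have finV: "finite ?V" by (rule finite_lists_length_eq[OF finite_balanced])
  have inj: "inj_on f ?V"
    using inj_on_concat_equal_length[of "balanced n" "2 * n" n] by (auto simp: inj_on_def f_def balanced_def)
  have card: "card ?W = card (balanced n) ^ n"
    using card_image[OF inj] card_lists_length_eq[OF finite_balanced] by simp
  have pos: "0 < 2 ^ n / (2 * real n + 1)" by (intro divide_pos_pos) auto
  have card_pos: "0 < real (card (balanced n))"
    using card_balanced[of n] pos by (meson less_le_trans zero_less_power)
  have dyck: "w \<in> dyck" "length w = 2 * (n + 1)\<^sup>2" if w: "w \<in> ?W" for w
  proof -
    obtain vs where vs: "w = f vs" "set vs \<subseteq> balanced n" "length vs = n" using w by auto
    show "w \<in> dyck" unfolding vs(1) f_def
    proof (rule padded_dyck)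
      show "- int (2 * n + 1) < wsum (take k (concat vs))" for k
        using balanced_concat(3)[OF vs(2), of k] by simp
    qed (simp add: balanced_concat(2)[OF vs(2)])
    show "length w = 2 * (n + 1)\<^sup>2"
      using balanced_concat(1)[OF vs(2)] vs(3) by (simp add: vs(1) f_def power2_eq_square algebra_simps)
  qed
  have "ereal ((ln (\<Sum>w\<in>?W. exp ((\<lambda>_. 0) w)) - 0) / real (2 * (n + 1)\<^sup>2))
      \<le> pressure_over {M \<in> invariant_measures UNIV. emeasure M (X_con dyck) = 1} (\<lambda>_. 0)"
  proof (rule pressure_over_ge[where K = 0])
    show "finite ?W" using finV by simp
    have "card ?W \<noteq> 0" using card card_pos by simp
    then show "?W \<noteq> {}" by (metis card.empty)
    show "X_con dyck \<in> sets borel" by (rule X_con_dyck_measurable)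
    show "(shift ^^ k) (periodic_code (2 * (n + 1)\<^sup>2) \<omega>) \<in> X_con dyck"
      if "\<And>j. \<omega> j \<in> ?W" "k < 2 * (n + 1)\<^sup>2" for \<omega> k
      using that dyck by (intro periodic_code_X_con) auto
  qed (use dyck(2) in auto)
  moreover have "real n * (real n * ln 2 - ln (2 * real n + 1)) / (real n + 1)\<^sup>2
      \<le> (ln (\<Sum>w\<in>?W. exp ((\<lambda>_. 0) w)) - 0) / real (2 * (n + 1)\<^sup>2)"
  proof -
    have "2 * (real n * ln 2 - ln (2 * real n + 1)) = ln ((2 ^ n / (2 * real n + 1))\<^sup>2)"
      using pos by (simp add: ln_realpow ln_div)
    also have "\<dots> \<le> ln (real (card (balanced n)))"
      using card_balanced[of n] pos card_pos by (subst ln_le_cancel_iff) auto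
    finally have "real n * (2 * (real n * ln 2 - ln (2 * real n + 1))) \<le> real n * ln (real (card (balanced n)))"
      by (intro mult_left_mono) auto
    also have "\<dots> = ln (real (card ?W))" using card_pos by (simp add: card ln_realpow)
    finally have "real n * (2 * (real n * ln 2 - ln (2 * real n + 1))) / (2 * (real n + 1)\<^sup>2)
        \<le> ln (real (card ?W)) / (2 * (real n + 1)\<^sup>2)"
      by (intro divide_right_mono) auto
    moreover have "real n * (2 * t) / (2 * u) = real n * t / u" for t u :: real by simp
    moreover have "(ln (\<Sum>w\<in>?W. exp ((\<lambda>_. 0) w)) - 0) / real (2 * (n + 1)\<^sup>2)
        = ln (real (card ?W)) / (2 * (real n + 1)\<^sup>2)"
      by (simp add: add.commute)
    ultimately show ?thesis by (simp only:)
  qed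
  ultimately show ?thesis by (meson ereal_less_eq(3) order_trans)
qed

lemma ln_2_le_pressure_over:
  "ereal (ln 2) \<le> pressure_over {M \<in> invariant_measures UNIV. emeasure M (X_con dyck) = 1} (\<lambda>_. 0)"
proof (rule Lim_bounded[where M = 1])
  have "(\<lambda>n. real n * (real n * ln 2 - ln (2 * real n + 1)) / (real n + 1)\<^sup>2) \<longlonglongrightarrow> ln 2"
    by real_asymp
  then show "(\<lambda>n. ereal (real n * (real n * ln 2 - ln (2 * real n + 1)) / (real n + 1)\<^sup>2)) \<longlonglongrightarrow> ereal (ln 2)"
    by (rule tendsto_ereal)
qed (use pressure_over_zero_ge in auto)

section \<open>Comparison of the pressures and conclusion\<close>

text \<open>Words of length 1 with zero potential already suffice: the partition function is then
  the number of letters.\<close>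

lemma h_top_le: "h_top (UNIV :: (int \<Rightarrow> sign) set) \<le> ereal (ln 2)"
  unfolding h_top_def
proof (rule SUP_least)
  fix M :: "(int \<Rightarrow> sign) measure" assume "M \<in> invariant_measures UNIV"
  then interpret shift_invariant M by (simp add: invariant_measures_UNIV_iff)
  have "card {w :: sign list. length w = 1} = 2"
    using card_lists_length_eq[OF finite[of "UNIV :: sign set"], of 1] by (simp add: CARD_sign)
  then show "ks_entropy M shift \<le> ereal (ln 2)"
    using free_energy_le[of "\<lambda>_. 0" 0 1 "\<lambda>_. 0" 0] by (simp add: ks_entropy_eq)
qed

lemma P_res_dyck:
  assumes "\<phi> \<in> C_space (coded_shift dyck)"
  shows "P_res \<phi> dyck = P_top (coded_shift dyck) \<phi>"
proof (rule antisym)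
  show "P_res \<phi> dyck \<le> P_top (coded_shift dyck) \<phi>"
    unfolding P_res_def P_top_def pressure_over_def by (intro SUP_subset_mono) auto
  have "continuous_on UNIV \<phi>" using assms by (simp add: C_space_def coded_shift_dyck)
  moreover have "X_res dyck \<in> sets borel" "drift_concat \<subseteq> X_res dyck"
    using X_con_dyck_measurable drift_concat_X_con by (auto simp: X_res_def coded_shift_dyck)
  ultimately show "P_top (coded_shift dyck) \<phi> \<le> P_res \<phi> dyck"
    unfolding P_top_def P_res_def coded_shift_dyck pressure_over_def[of "invariant_measures UNIV"]
    by (intro SUP_least free_energy_le_pressure_over) (simp_all only: invariant_measures_UNIV_iff)
qed

theorem theorem1p2:
  shows "\<exists>G :: sign list set.
    countable G \<and> G \<noteq> {} \<and> [] \<notin> G \<and>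
    uniquely_represents G \<and>
    coded_shift G = UNIV \<and>
    (\<forall>\<phi>\<in>C_space (coded_shift G). P_res \<phi> G = P_top (coded_shift G) \<phi>) \<and>
    P_seq (\<lambda>_. 0) G = h_top (coded_shift G) \<and>
    h_top (coded_shift G) = ereal (ln 2) \<and>
    SSP G = {} \<and> FSSP G = {} \<and>
    (\<lambda>_. 0) \<in> FSP G \<and>
    FSP G \<noteq> FSSP G"
proof (intro exI[of _ dyck] conjI ballI)
  have top0: "P_top (coded_shift dyck) (\<lambda>_. 0) = h_top (coded_shift dyck)"
    by (simp add: P_top_def pressure_over_def h_top_def)
  have seq_le: "P_seq \<phi> dyck \<le> P_top (coded_shift dyck) \<phi>" for \<phi>
    unfolding P_seq_def P_top_def pressure_over_def by (intro SUP_subset_mono) auto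
  have seq_ge: "ereal (ln 2) \<le> P_seq (\<lambda>_. 0) dyck"
    using ln_2_le_pressure_over by (simp add: P_seq_def coded_shift_dyck)
  have top_le: "h_top (coded_shift dyck) \<le> ereal (ln 2)"
    using h_top_le by (simp add: coded_shift_dyck)
  \<comment> \<open>At the zero potential the chain
    \<open>ln 2 \<le> P_seq \<le> P_top = h_top \<le> ln 2\<close> closes up.\<close>
  show seq: "P_seq (\<lambda>_. 0) dyck = h_top (coded_shift dyck)"
    using seq_ge seq_le[of "\<lambda>_. 0"] top_le top0 by simp
  show "h_top (coded_shift dyck) = ereal (ln 2)" using seq seq_ge top_le by simp
  show "countable dyck" by (rule countable_subset[OF subset_UNIV]) simp
  have "replicate 1 Plus @ [] @ replicate 1 Minus \<in> dyck" by (rule padded_dyck) auto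
  then show "dyck \<noteq> {}" by blast
  show "[] \<notin> dyck" by (simp add: dyck_def)
  show "uniquely_represents dyck" by (rule uniquely_represents_dyck)
  show "coded_shift dyck = UNIV" by (rule coded_shift_dyck)
  show "P_res \<phi> dyck = P_top (coded_shift dyck) \<phi>" if "\<phi> \<in> C_space (coded_shift dyck)" for \<phi>
    using that by (rule P_res_dyck)
  \<comment> \<open>Since \<open>P_seq\<close> is at most \<open>P_top\<close>, which equals
    \<open>P_res\<close>, the strict inequality never holds.\<close>
  show SSP: "SSP dyck = {}" using P_res_dyck seq_le by (auto simp: SSP_def not_less)
  then show FSSP: "FSSP dyck = {}" by (simp add: FSSP_def)
  \<comment> \<open>Over the full space every function is extensional, so the constant 0 lies in
    \<open>C_space\<close>.\<close>
  show FSP: "(\<lambda>_. 0) \<in> FSP dyck"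
    using seq top0 by (simp add: FSP_def C_space_def coded_shift_dyck)
  then show "FSP dyck \<noteq> FSSP dyck" using FSSP by blast
qed

end
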